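(* Let $n\ge2$ and let $\mathcal{F} \subseteq \Pi$, where $\Pi$ is the space of equivalence classes of paths $[0,1]\to\mathbb{R}^n$ under reparameterization, with the metric $\rho$. Then the closure $\overline{\mathcal{F}}$ of $\mathcal{F}$ in $\Pi$ is compact if and only if the following two properties are satisfied: (1) the set $\{\gamma(0): [\gamma] \in \mathcal{F}\}$ is bounded; and (2) for each $\varepsilon > 0$, there is a positive integer $N$ such that for every $[\gamma] \in \mathcal{F}$, there is no collection of more than $N$ pairwise disjoint subintervals of $[0,1]$ whose images under $\gamma$ have diameters $\geq \varepsilon$.
   Context: A path is a continuous map $\gamma:[0,1]\to\mathbb{R}^n$. Reparameterization: $\gamma_1\approx\gamma_2$ if there are non-decreasing onto maps $m_1,m_2:[0,1]\to[0,1]$ such that $\gamma_i$ is constant on each fiber $m_i^{-1}(s)$, $s\in[0,1]$, for $i=1,2$, and $\gamma_1\circ m_1^{-1}=\gamma_2\circ m_2^{-1}$. This is an equivalence relation on paths; $[\gamma]$ is the class of $\gamma$ and $\Pi$ is the set of all classes. The metric on $\Pi$ is $\rho([\gamma_1],[\gamma_2])=\inf\{\sup_{t\in[0,1]}|\lambda_1(t)-\lambda_2(t)|:\lambda_1\in[\gamma_1],\lambda_2\in[\gamma_2]\}$. *)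

theory Defs
  imports "HOL-Analysis.Analysis"
begin

text \<open>
  Paths are functions on all of \<open>real\<close> of which only the values on \<open>{0..1}\<close> matter. The relation
  below looks only at those values, so two representations of the same map on \<open>{0..1}\<close> lie in
  the same class. Composition with \<open>m\<close>-inverse is composition of relations: for \<open>s\<close> in \<open>{0..1}\<close>,
  its value at \<open>s\<close> is the image of the fiber of \<open>m\<close> over \<open>s\<close>, a singleton since \<open>m\<close> is onto and
  the path is constant on fibers.
\<close>

definition constant_on_fibers :: "(real \<Rightarrow> 'a) \<Rightarrow> (real \<Rightarrow> real) \<Rightarrow> bool" where
  "constant_on_fibers \<gamma> m \<longleftrightarrow>
     (\<forall>s\<in>{0..1}. \<gamma> constant_on ({0..1} \<inter> m -` {s}))"

definition reparam_rel :: "((real \<Rightarrow> 'a::real_normed_vector) \<times> (real \<Rightarrow> 'a)) set" where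
  "reparam_rel = {(\<gamma>1, \<gamma>2). path \<gamma>1 \<and> path \<gamma>2 \<and>
     (\<exists>m1 m2 :: real \<Rightarrow> real.
        mono_on {0..1} m1 \<and> m1 ` {0..1} = {0..1} \<and>
        mono_on {0..1} m2 \<and> m2 ` {0..1} = {0..1} \<and>
        constant_on_fibers \<gamma>1 m1 \<and> constant_on_fibers \<gamma>2 m2 \<and>
        (\<forall>s\<in>{0..1}. \<gamma>1 ` ({0..1} \<inter> m1 -` {s}) = \<gamma>2 ` ({0..1} \<inter> m2 -` {s})))}"

definition curve_class :: "(real \<Rightarrow> 'a::real_normed_vector) \<Rightarrow> (real \<Rightarrow> 'a) set" where
  "curve_class \<gamma> = reparam_rel `` {\<gamma>}"

definition curve_space :: "(real \<Rightarrow> 'a::real_normed_vector) set set" where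
  "curve_space = Collect path // reparam_rel"

text \<open>
  The value \<open>0\<close> off \<open>curve_space\<close> is needed because the locale \<open>Metric_space\<close> demands nonnegativity
  for all arguments, while \<open>Inf\<close> and \<open>Sup\<close> of empty or unbounded sets of reals are unspecified.
\<close>

definition curve_dist :: "(real \<Rightarrow> 'a::real_normed_vector) set \<Rightarrow> (real \<Rightarrow> 'a) set \<Rightarrow> real" where
  "curve_dist c1 c2 =
     (if c1 \<in> curve_space \<and> c2 \<in> curve_space
      then Inf {SUP t\<in>{0..1}. norm (l1 t - l2 t) | l1 l2. l1 \<in> c1 \<and> l2 \<in> c2}
      else 0)"

definition curve_topology :: "(real \<Rightarrow> 'a::real_normed_vector) set topology" where
  "curve_topology = Metric_space.mtopology curve_space curve_dist"

end

theory Submission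
  imports Defs "HOL-Complex_Analysis.Great_Picard"
begin

text \<open>
  Two paths are equivalent iff their Frechet distance, taken over homeomorphisms of the unit interval,
  vanishes, so \<open>curve_dist\<close> is the Frechet distance of representatives and hence a metric.

  If the closure of \<open>F\<close> is compact, then \<open>F\<close> is totally bounded; a finite net consists of uniformly
  continuous paths, and a large oscillation of a curve near such a path forces a large oscillation of
  that path, of which there are boundedly many. Conversely, let \<open>\<tau>\<^sub>k t\<close> be the maximal number of
  disjoint intervals in \<open>[0, t)\<close> whose images have diameter at least \<open>2\<close> to the power \<open>-k\<close>, and let
  \<open>N\<^sub>k\<close> be the uniform bound for it. Reparametrizing each path by the generalized inverse of
  the normalized sum of \<open>t\<close> and the weighted terms \<open>\<tau>\<^sub>k t / N\<^sub>k\<close> makes the family equicontinuous, and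
  the theorem of Arzela and Ascoli applies.
\<close>

subsection \<open>Monotone reparametrizations\<close>

text \<open>Homeomorphisms are used because they can be inverted and composed, so symmetry and the
  triangle inequality are immediate; collapsing maps are still covered in the limit, by mixing them
  with a little of the identity. The obstacle is the separation axiom: distance zero yields only a
  sequence of homeomorphisms, whose limit may collapse intervals and provides a common lift of the
  two paths, whereas the relation demands a common quotient.

  In the converse direction, a path that moves by at least 2^-k raises the k-th count by one, which
  costs at least \<open>(1/2)^(k+2) / N k\<close> of the new parameter. This price is the same for
  every path of the family, and that is equicontinuity. The summand \<open>t\<close> keeps the new
  parameter strictly increasing where no count grows. The counts make it jump, but strict
  monotonicity is enough for its generalized inverse to be continuous.\<close>

definition unit_onto :: "(real \<Rightarrow> real) \<Rightarrow> bool" where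
  "unit_onto m \<longleftrightarrow> mono_on {0..1} m \<and> m ` {0..1} = {0..1}"

definition unit_homeo :: "(real \<Rightarrow> real) \<Rightarrow> bool" where
  "unit_homeo h \<longleftrightarrow> strict_mono_on {0..1} h \<and> h ` {0..1} = {0..1}"

lemma unit_onto_mono: "unit_onto m \<Longrightarrow> 0 \<le> s \<Longrightarrow> s \<le> t \<Longrightarrow> t \<le> 1 \<Longrightarrow> m s \<le> m t"
  unfolding unit_onto_def by (auto intro: mono_onD)

lemma unit_onto_range:
  assumes "unit_onto m" "0 \<le> t" "t \<le> 1"
  shows "0 \<le> m t" "m t \<le> 1"
proof -
  have "m t \<in> {0..1}"
    using assms unfolding unit_onto_def by (metis atLeastAtMost_iff imageI)
  then show "0 \<le> m t" "m t \<le> 1" by auto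
qed

lemma unit_onto_surj:
  assumes "unit_onto m" "0 \<le> s" "s \<le> 1"
  obtains t where "0 \<le> t" "t \<le> 1" "m t = s"
proof -
  have "s \<in> m ` {0..1}"
    using assms unfolding unit_onto_def by auto
  then show ?thesis using that by auto
qed

lemma unit_onto_ends:
  assumes "unit_onto m"
  shows "m 0 = 0" "m 1 = 1"
proof -
  obtain s where "0 \<le> s" "s \<le> 1" "m s = 0" by (rule unit_onto_surj [OF assms, of 0]) auto
  then show "m 0 = 0"
    using unit_onto_mono[OF assms, of 0 s] unit_onto_range[OF assms, of 0] by auto
  obtain t where "0 \<le> t" "t \<le> 1" "m t = 1" by (rule unit_onto_surj [OF assms, of 1]) auto
  then show "m 1 = 1"
    using unit_onto_mono[OF assms, of t 1] unit_onto_range[OF assms, of 1] by auto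
qed

text \<open>A jump of a monotone map would leave values out. The library criterion wants an open
  image, so the map is extended by the identity to a monotone map of the line onto itself.\<close>

lemma unit_onto_continuous:
  assumes m: "unit_onto m"
  shows "continuous_on {0..1} m"
proof -
  define f where "f x = (if x \<in> {0..1} then m x else x)" for x
  have r: "0 \<le> m x \<and> m x \<le> 1" if "0 \<le> x" "x \<le> 1" for x
    using unit_onto_range[OF m] that by auto
  have "range f = UNIV"
  proof -
    have "\<exists>x. f x = y" for y
    proof (cases "0 \<le> y \<and> y \<le> 1")
      case True
      then show ?thesis using unit_onto_surj[OF m, of y] unfolding f_def by (metis atLeastAtMost_iff)
    qed (auto simp: f_def)
    then show ?thesis by (metis surjI surj_def)
  qed
  moreover have "f x \<le> f y" if "x \<le> y" for x y
    using that r[of x] r[of y] unit_onto_mono[OF m, of x y] by (auto simp: f_def)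
  ultimately have "continuous_on UNIV f"
    by (intro continuous_onI_mono) auto
  then have "continuous_on {0..1} f" by (rule continuous_on_subset) simp
  then show ?thesis by (rule continuous_on_eq) (simp add: f_def)
qed

lemma unit_ontoI:
  assumes "\<And>s t. 0 \<le> s \<Longrightarrow> s \<le> t \<Longrightarrow> t \<le> 1 \<Longrightarrow> m s \<le> m t"
    and "continuous_on {0..1} m" "m 0 = 0" "m 1 = 1"
  shows "unit_onto m"
  unfolding unit_onto_def
proof
  show "mono_on {0..1} m" using assms(1) by (auto intro!: mono_onI)
  show "m ` {0..1} = {0..1}"
  proof
    show "m ` {0..1} \<subseteq> {0..1}"
      using assms(1)[of 0] assms(1)[of _ 1] assms(3,4) by auto
    show "{0..1} \<subseteq> m ` {0..1}"
    proof
      fix y :: real assume "y \<in> {0..1}"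
      then have "\<exists>x\<ge>0. x \<le> 1 \<and> m x = y"
        using assms by (intro IVT') auto
      then show "y \<in> m ` {0..1}" by auto
    qed
  qed
qed

lemma unit_homeo_onto: "unit_homeo h \<Longrightarrow> unit_onto h"
  unfolding unit_homeo_def unit_onto_def by (auto intro: strict_mono_on_imp_mono_on)

lemma unit_homeoI:
  assumes "unit_onto h" "\<And>s t. 0 \<le> s \<Longrightarrow> s < t \<Longrightarrow> t \<le> 1 \<Longrightarrow> h s < h t"
  shows "unit_homeo h"
  using assms unfolding unit_homeo_def unit_onto_def by (auto intro!: strict_mono_onI)

lemma unit_homeo_strict: "unit_homeo h \<Longrightarrow> 0 \<le> s \<Longrightarrow> s < t \<Longrightarrow> t \<le> 1 \<Longrightarrow> h s < h t"
  unfolding unit_homeo_def by (auto intro: strict_mono_onD[of "{0..1}"])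

lemma unit_homeo_less_iff:
  "unit_homeo h \<Longrightarrow> s \<in> {0..1} \<Longrightarrow> t \<in> {0..1} \<Longrightarrow> h s < h t \<longleftrightarrow> s < t"
  unfolding unit_homeo_def using strict_mono_on_less[of "{0..1}" h s t] by blast

lemma unit_homeo_le_iff:
  "unit_homeo h \<Longrightarrow> s \<in> {0..1} \<Longrightarrow> t \<in> {0..1} \<Longrightarrow> h s \<le> h t \<longleftrightarrow> s \<le> t"
  unfolding unit_homeo_def using strict_mono_on_less_eq[of "{0..1}" h s t] by blast

lemma unit_onto_id: "unit_onto (\<lambda>t. t)"
  unfolding unit_onto_def by (auto intro!: mono_onI)

lemma unit_homeo_id: "unit_homeo (\<lambda>t. t)"
  unfolding unit_homeo_def by (auto intro!: strict_mono_onI)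

lemma unit_homeo_comp:
  assumes "unit_homeo h" "unit_homeo k"
  shows "unit_homeo (\<lambda>t. h (k t))"
proof (rule unit_homeoI)
  note o = assms[THEN unit_homeo_onto]
  show "h (k s) < h (k t)" if "0 \<le> s" "s < t" "t \<le> 1" for s t
    using that assms(1)[THEN unit_homeo_strict, of "k s" "k t"] assms(2)[THEN unit_homeo_strict, of s t]
      unit_onto_range[OF o(2), of s] unit_onto_range[OF o(2), of t] by auto
  have "(\<lambda>t. h (k t)) ` {0..1} = {0..1}"
    using o unfolding unit_onto_def by (metis image_image)
  moreover have "mono_on {0..1} (\<lambda>t. h (k t))"
    using o unit_onto_mono[OF o(1)] unit_onto_mono[OF o(2)] unit_onto_range[OF o(2)]
    by (intro mono_onI) auto
  ultimately show "unit_onto (\<lambda>t. h (k t))" unfolding unit_onto_def by blast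
qed

lemma unit_homeo_inverse:
  assumes h: "unit_homeo h"
  obtains k where "unit_homeo k" "\<And>t. t \<in> {0..1} \<Longrightarrow> h (k t) = t" "\<And>t. t \<in> {0..1} \<Longrightarrow> k (h t) = t"
proof -
  define k where "k = inv_into {0..1} h"
  have im: "h ` {0..1} = {0..1}" and inj: "inj_on h {0..1}"
    using h unfolding unit_homeo_def by (auto intro: strict_mono_on_imp_inj_on)
  have hk: "h (k t) = t" if "t \<in> {0..1}" for t
    using that im unfolding k_def by (metis f_inv_into_f)
  have kh: "k (h t) = t" if "t \<in> {0..1}" for t
    using that inj unfolding k_def by simp
  have k01: "k t \<in> {0..1}" if "t \<in> {0..1}" for t
    using that im unfolding k_def by (metis inv_into_into)
  have "k ` {0..1} = {0..1}"
  proof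
    show "k ` {0..1} \<subseteq> {0..1}" using k01 by blast
    show "{0..1} \<subseteq> k ` {0..1}"
    proof
      fix t :: real assume "t \<in> {0..1}"
      then show "t \<in> k ` {0..1}" using kh im by (metis imageI)
    qed
  qed
  moreover have "strict_mono_on {0..1} k"
  proof (rule strict_mono_onI)
    fix s t :: real assume st: "s \<in> {0..1}" "t \<in> {0..1}" "s < t"
    show "k s < k t"
      using unit_homeo_less_iff[OF h, of "k s" "k t"] k01[OF st(1)] k01[OF st(2)] hk[OF st(1)] hk[OF st(2)] st(3) by simp
  qed
  ultimately show ?thesis using that[of k] hk kh unfolding unit_homeo_def by blast
qed

text \<open>A small multiple of the identity makes a monotone map strictly increasing, and the
  change is at most \<open>e\<close> because both maps take values in the unit interval.\<close>

lemma unit_homeo_approx: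
  assumes m: "unit_onto m" and e: "0 < e" "e \<le> 1"
  obtains h where "unit_homeo h" "\<And>t. t \<in> {0..1} \<Longrightarrow> \<bar>h t - m t\<bar> \<le> e"
proof -
  define h where "h t = (1 - e) * m t + e * t" for t
  have mono: "h s < h t" if "0 \<le> s" "s < t" "t \<le> 1" for s t
    using that e unit_onto_mono[OF m, of s t] unfolding h_def
    by (intro add_le_less_mono mult_left_mono mult_strict_left_mono) auto
  have "unit_homeo h"
  proof (intro unit_homeoI unit_ontoI)
    show "h s \<le> h t" if "0 \<le> s" "s \<le> t" "t \<le> 1" for s t
      using mono[of s t] that by (cases "s = t") auto
    show "continuous_on {0..1} h"
      unfolding h_def by (intro continuous_intros unit_onto_continuous m)
  qed (use mono unit_onto_ends[OF m] in \<open>auto simp: h_def\<close>)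
  moreover have "\<bar>h t - m t\<bar> \<le> e" if "t \<in> {0..1}" for t
  proof -
    have "h t - m t = e * (t - m t)" unfolding h_def by (simp add: algebra_simps)
    moreover have "\<bar>t - m t\<bar> \<le> 1" using unit_onto_range[OF m, of t] that by auto
    ultimately show ?thesis using e by (simp add: abs_mult mult_left_le)
  qed
  ultimately show ?thesis using that by blast
qed

lemma path_comp_unit_onto:
  assumes "path \<gamma>" "unit_onto m"
  shows "path (\<lambda>t. \<gamma> (m t))"
  using assms continuous_on_compose2[of "{0..1}" \<gamma> "{0..1}" m] unit_onto_continuous[OF assms(2)]
  unfolding path_def unit_onto_def by auto

subsection \<open>The Frechet pseudometric\<close>

text \<open>The bound is attained by a single homeomorphism. Distance zero is therefore expressed by
  all \<open>e > 0\<close>; \<open>frechet_le 0\<close> would make one path an exact homeomorphic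
  reparametrization of the other, which is stronger.\<close>

definition frechet_le :: "real \<Rightarrow> (real \<Rightarrow> 'a::real_normed_vector) \<Rightarrow> (real \<Rightarrow> 'a) \<Rightarrow> bool" where
  "frechet_le e \<gamma>1 \<gamma>2 \<longleftrightarrow> (\<exists>h. unit_homeo h \<and> (\<forall>t\<in>{0..1}. norm (\<gamma>1 t - \<gamma>2 (h t)) \<le> e))"

lemma frechet_le_uniform: "(\<And>t. t \<in> {0..1} \<Longrightarrow> norm (\<gamma>1 t - \<gamma>2 t) \<le> e) \<Longrightarrow> frechet_le e \<gamma>1 \<gamma>2"
  unfolding frechet_le_def using unit_homeo_id by auto

lemma unit_homeo_in: "unit_homeo h \<Longrightarrow> t \<in> {0..1} \<Longrightarrow> h t \<in> {0..1}"
  unfolding unit_homeo_def by blast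

lemma frechet_le_sym:
  assumes "frechet_le e \<gamma>1 \<gamma>2"
  shows "frechet_le e \<gamma>2 \<gamma>1"
proof -
  obtain h where h: "unit_homeo h" "\<forall>t\<in>{0..1}. norm (\<gamma>1 t - \<gamma>2 (h t)) \<le> e"
    using assms unfolding frechet_le_def by blast
  obtain k where k: "unit_homeo k" "\<And>t. t \<in> {0..1} \<Longrightarrow> h (k t) = t"
      "\<And>t. t \<in> {0..1} \<Longrightarrow> k (h t) = t"
    by (rule unit_homeo_inverse[OF h(1)]) auto
  have "norm (\<gamma>2 t - \<gamma>1 (k t)) \<le> e" if "t \<in> {0..1}" for t
    using bspec[OF h(2) unit_homeo_in[OF k(1) that]] k(2)[OF that] by (simp add: norm_minus_commute)
  then show ?thesis using k(1) unfolding frechet_le_def by blast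
qed

lemma frechet_le_trans:
  assumes "frechet_le d \<gamma>1 \<gamma>2" "frechet_le e \<gamma>2 \<gamma>3"
  shows "frechet_le (d + e) \<gamma>1 \<gamma>3"
proof -
  obtain h where h: "unit_homeo h" "\<forall>t\<in>{0..1}. norm (\<gamma>1 t - \<gamma>2 (h t)) \<le> d"
    using assms(1) unfolding frechet_le_def by blast
  obtain k where k: "unit_homeo k" "\<forall>t\<in>{0..1}. norm (\<gamma>2 t - \<gamma>3 (k t)) \<le> e"
    using assms(2) unfolding frechet_le_def by blast
  have "norm (\<gamma>1 t - \<gamma>3 (k (h t))) \<le> d + e" if "t \<in> {0..1}" for t
    using norm_triangle_mono[OF bspec[OF h(2) that] bspec[OF k(2) unit_homeo_in[OF h(1) that]]] by simp
  then show ?thesis using unit_homeo_comp[OF k(1) h(1)] unfolding frechet_le_def by blast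
qed

text \<open>A homeomorphism uniformly close to \<open>m\<close> does the matching, by uniform
  continuity of the path. The bound must be positive because \<open>m\<close> may collapse
  intervals.\<close>

lemma frechet_le_comp:
  assumes \<gamma>: "path \<gamma>" and m: "unit_onto m" and e: "e > 0"
  shows "frechet_le e (\<lambda>t. \<gamma> (m t)) \<gamma>"
proof -
  have "uniformly_continuous_on {0..1} \<gamma>"
    using \<gamma> unfolding path_def by (simp add: compact_uniformly_continuous)
  then obtain d where d: "d > 0"
      "\<And>s t. s \<in> {0..1} \<Longrightarrow> t \<in> {0..1} \<Longrightarrow> dist s t < d \<Longrightarrow> dist (\<gamma> s) (\<gamma> t) < e"
    unfolding uniformly_continuous_on_def using e by metis
  obtain h where h: "unit_homeo h" "\<And>t. t \<in> {0..1} \<Longrightarrow> \<bar>h t - m t\<bar> \<le> min 1 (d/2)"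
    by (rule unit_homeo_approx[OF m, of "min 1 (d/2)"]) (use d in auto)
  have "norm (\<gamma> (m t) - \<gamma> (h t)) \<le> e" if t: "t \<in> {0..1}" for t
  proof -
    have "\<bar>m t - h t\<bar> < d" using h(2)[OF t] d(1) by linarith
    then show ?thesis
      using d(2)[of "m t" "h t"] unit_homeo_in[OF h(1) t] unit_onto_range[OF m, of t] t
      by (simp add: dist_norm)
  qed
  then show ?thesis unfolding frechet_le_def using h(1) by blast
qed

lemma reparam_rel_iff_unit_onto:
  "(\<gamma>1, \<gamma>2) \<in> reparam_rel \<longleftrightarrow> path \<gamma>1 \<and> path \<gamma>2 \<and>
     (\<exists>m1 m2. unit_onto m1 \<and> unit_onto m2 \<and> constant_on_fibers \<gamma>1 m1 \<and> constant_on_fibers \<gamma>2 m2 \<and>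
        (\<forall>s\<in>{0..1}. \<gamma>1 ` ({0..1} \<inter> m1 -` {s}) = \<gamma>2 ` ({0..1} \<inter> m2 -` {s})))"
  unfolding reparam_rel_def unit_onto_def by auto

text \<open>A monotone surjection of the compact interval is a quotient map.\<close>

lemma path_factor:
  assumes \<gamma>: "path \<gamma>" and m: "unit_onto m"
    and g: "\<And>t. t \<in> {0..1} \<Longrightarrow> \<gamma> t = g (m t)"
  shows "path g"
proof -
  have "closed (g -` B \<inter> {0..1})" if "closed B" for B
  proof -
    \<comment> \<open>The right-hand side is a continuous image of a compact set, hence
      closed.\<close>
    have "g -` B \<inter> {0..1} = m ` (\<gamma> -` B \<inter> {0..1})"
    proof
      show "m ` (\<gamma> -` B \<inter> {0..1}) \<subseteq> g -` B \<inter> {0..1}"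
        using g unit_onto_range[OF m] by auto
      show "g -` B \<inter> {0..1} \<subseteq> m ` (\<gamma> -` B \<inter> {0..1})"
      proof
        fix s assume s: "s \<in> g -` B \<inter> {0..1}"
        then obtain t where "0 \<le> t" "t \<le> 1" "m t = s" using unit_onto_surj[OF m, of s] by auto
        then show "s \<in> m ` (\<gamma> -` B \<inter> {0..1})" using s g[of t] by auto
      qed
    qed
    moreover have "closed (\<gamma> -` B \<inter> {0..1})"
      using \<gamma> that unfolding path_def by (simp add: continuous_on_closed_vimage)
    then have "compact (\<gamma> -` B \<inter> {0..1})"
      by (metis bounded_Int bounded_closed_interval compact_eq_bounded_closed)
    then have "compact (m ` (\<gamma> -` B \<inter> {0..1}))"
      by (intro compact_continuous_image continuous_on_subset[OF unit_onto_continuous[OF m]]) auto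
    ultimately show ?thesis by (simp add: compact_imp_closed)
  qed
  then show ?thesis unfolding path_def by (simp add: continuous_on_closed_vimage)
qed

text \<open>Both paths factor through one path \<open>g\<close> on the common quotient, and each is
  arbitrarily close to \<open>g\<close> by \<open>frechet_le_comp\<close>.\<close>

lemma reparam_rel_imp_frechet_le:
  assumes r: "(\<gamma>1, \<gamma>2) \<in> reparam_rel" and e: "e > 0"
  shows "frechet_le e \<gamma>1 \<gamma>2"
proof -
  obtain m1 m2 where \<gamma>: "path \<gamma>1" "path \<gamma>2" and m: "unit_onto m1" "unit_onto m2"
    and c: "constant_on_fibers \<gamma>1 m1" "constant_on_fibers \<gamma>2 m2"
    and eq: "\<forall>s\<in>{0..1}. \<gamma>1 ` ({0..1} \<inter> m1 -` {s}) = \<gamma>2 ` ({0..1} \<inter> m2 -` {s})"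
    using r unfolding reparam_rel_iff_unit_onto by blast
  \<comment> \<open>On the unit interval the choice is forced: the image of each fiber is a
    singleton.\<close>
  define g where "g s = (SOME x. x \<in> \<gamma>1 ` ({0..1} \<inter> m1 -` {s}))" for s
  have g1: "\<gamma>1 t = g (m1 t)" if "t \<in> {0..1}" for t
  proof -
    have "g (m1 t) \<in> \<gamma>1 ` ({0..1} \<inter> m1 -` {m1 t})"
      unfolding g_def by (rule someI[of _ "\<gamma>1 t"]) (use that in auto)
    moreover have "m1 t \<in> {0..1}" using unit_onto_range[OF m(1)] that by auto
    ultimately show ?thesis using c(1) that unfolding constant_on_fibers_def constant_on_def by fastforce
  qed
  have g2: "\<gamma>2 t = g (m2 t)" if "t \<in> {0..1}" for t
  proof -
    have m2t: "m2 t \<in> {0..1}" using unit_onto_range[OF m(2)] that by auto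
    have "\<gamma>2 t \<in> \<gamma>1 ` ({0..1} \<inter> m1 -` {m2 t})" using bspec[OF eq m2t] that by auto
    then show ?thesis using g1 by auto
  qed
  have pg: "path g" using path_factor[OF \<gamma>(1) m(1)] g1 by blast
  have "frechet_le (e/2) \<gamma>1 g"
    using frechet_le_comp[OF pg m(1), of "e/2"] e g1 unfolding frechet_le_def by auto
  moreover have "frechet_le (e/2) \<gamma>2 g"
    using frechet_le_comp[OF pg m(2), of "e/2"] e g2 unfolding frechet_le_def by auto
  ultimately show ?thesis using frechet_le_trans[of "e/2" \<gamma>1 g "e/2" \<gamma>2] frechet_le_sym by auto
qed

subsection \<open>Frechet distance zero\<close>

text \<open>
  Near-optimal homeomorphisms \<open>h\<close> need not converge. Parametrizing the graph of \<open>h\<close> by half the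
  sum of its coordinates turns \<open>h\<close> into a pair of monotone maps \<open>p\<close> and \<open>2 t - p t\<close>, both
  2-Lipschitz, to which the theorem of Arzela and Ascoli applies.
\<close>

lemma frechet_le_zero_imp_common_lift:
  assumes \<gamma>: "path \<gamma>1" "path \<gamma>2" and le: "\<And>e. e > 0 \<Longrightarrow> frechet_le e \<gamma>1 \<gamma>2"
  obtains p1 p2 where "unit_onto p1" "unit_onto p2" "\<And>t. t \<in> {0..1} \<Longrightarrow> \<gamma>1 (p1 t) = \<gamma>2 (p2 t)"
proof -
  have "\<exists>p. unit_homeo p \<and> unit_onto (\<lambda>t. 2 * t - p t) \<and>
          (\<forall>t\<in>{0..1}. norm (\<gamma>1 (p t) - \<gamma>2 (2 * t - p t)) \<le> inverse (real (Suc n)))" for n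
  proof -
    obtain h where h: "unit_homeo h" "\<forall>t\<in>{0..1}. norm (\<gamma>1 t - \<gamma>2 (h t)) \<le> inverse (real (Suc n))"
      using le[of "inverse (real (Suc n))"] unfolding frechet_le_def by auto
    define u where "u t = (t + h t) / 2" for t
    have "unit_homeo u"
    proof (intro unit_homeoI unit_ontoI)
      note o = unit_homeo_onto[OF h(1)]
      show "u s \<le> u t" if "0 \<le> s" "s \<le> t" "t \<le> 1" for s t
        using unit_onto_mono[OF o that] that by (simp add: u_def)
      show "u s < u t" if "0 \<le> s" "s < t" "t \<le> 1" for s t
        using unit_homeo_strict[OF h(1) that] that by (simp add: u_def)
      show "continuous_on {0..1} u"
        unfolding u_def by (intro continuous_intros unit_onto_continuous o) auto
    qed (use unit_onto_ends[OF unit_homeo_onto[OF h(1)]] in \<open>auto simp: u_def\<close>)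
    then obtain p where p: "unit_homeo p" "\<And>t. t \<in> {0..1} \<Longrightarrow> u (p t) = t"
        "\<And>t. t \<in> {0..1} \<Longrightarrow> p (u t) = t"
      by (rule unit_homeo_inverse) auto
    have hp: "h (p t) = 2 * t - p t" if "t \<in> {0..1}" for t
      using p(2)[OF that] by (simp add: u_def field_simps)
    have "unit_onto (\<lambda>t. h (p t))"
      by (rule unit_homeo_onto[OF unit_homeo_comp[OF h(1) p(1)]])
    then have "unit_onto (\<lambda>t. 2 * t - p t)"
      using hp unfolding unit_onto_def mono_on_def by simp
    moreover have "norm (\<gamma>1 (p t) - \<gamma>2 (2 * t - p t)) \<le> inverse (real (Suc n))" if "t \<in> {0..1}" for t
      using bspec[OF h(2) unit_homeo_in[OF p(1) that]] hp[OF that] by simp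
    ultimately show ?thesis using p(1) by blast
  qed
  then obtain p where p: "\<And>n. unit_homeo (p n)" "\<And>n. unit_onto (\<lambda>t. 2 * t - p n t)"
     "\<And>n t. t\<in>{0..1} \<Longrightarrow> norm (\<gamma>1 (p n t) - \<gamma>2 (2 * t - p n t)) \<le> inverse (real (Suc n))"
    by metis
  note po = unit_homeo_onto[OF p(1)]
  \<comment> \<open>Since \<open>2 * t - p n t\<close> is monotone as well, \<open>p n\<close> can
    grow by at most twice the increment of \<open>t\<close>.\<close>
  have lip0: "\<bar>p n s - p n t\<bar> \<le> 2 * \<bar>s - t\<bar>" if "0 \<le> s" "s \<le> t" "t \<le> 1" for n s t
    using unit_onto_mono[OF po that, of n] unit_onto_mono[OF p(2) that, of n] that by auto
  have lip: "\<bar>p n s - p n t\<bar> \<le> 2 * \<bar>s - t\<bar>" if "s \<in> {0..1}" "t \<in> {0..1}" for n s t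
    using lip0[of s t n] lip0[of t s n] that by (cases "s \<le> t") auto
  obtain g k where g: "continuous_on {0..1} g" and k: "strict_mono (k :: nat \<Rightarrow> nat)"
    and unif: "\<And>e. 0 < e \<Longrightarrow> \<exists>N. \<forall>n x. n \<ge> N \<and> x \<in> {0..1} \<longrightarrow> norm (p (k n) x - g x) < e"
  proof (rule Arzela_Ascoli[of "{0..1::real}" p 1])
    show "norm (p n x) \<le> 1" if "x \<in> {0..1}" for n x
      using unit_onto_range[OF po, of x] that by auto
    show "\<exists>d>0. \<forall>n y. y \<in> {0..1} \<and> norm (x - y) < d \<longrightarrow> norm (p n x - p n y) < e"
      if "x \<in> {0..1}" "0 < e" for x e
    proof (intro exI[of _ "e/2"] conjI allI impI)
      fix n y assume "y \<in> {0..1} \<and> norm (x - y) < e / 2"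
      then show "norm (p n x - p n y) < e"
        using lip[OF that(1), of y n] by auto
    qed (use that in auto)
  qed auto
  have lim: "(\<lambda>n. p (k n) t) \<longlonglongrightarrow> g t" if "t \<in> {0..1}" for t
    unfolding LIMSEQ_iff using unif that by blast
  \<comment> \<open>Strictness may be lost in the limit, so the resulting lift consists of monotone
    surjections only.\<close>
  have o1: "unit_onto g"
  proof (rule unit_ontoI)
    show "g s \<le> g t" if "0 \<le> s" "s \<le> t" "t \<le> 1" for s t
      by (rule LIMSEQ_le[OF lim[of s] lim[of t]]) (use that unit_onto_mono[OF po] in auto)
    show "g 0 = 0" "g 1 = 1"
      using lim[of 0] lim[of 1] unit_onto_ends[OF po] by (auto simp: LIMSEQ_const_iff)
  qed (rule g)
  have lim2: "(\<lambda>n. 2 * t - p (k n) t) \<longlonglongrightarrow> 2 * t - g t" if "t \<in> {0..1}" for t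
    by (intro tendsto_intros lim that)
  have o2: "unit_onto (\<lambda>t. 2 * t - g t)"
  proof (rule unit_ontoI)
    show "2 * s - g s \<le> 2 * t - g t" if "0 \<le> s" "s \<le> t" "t \<le> 1" for s t
      by (rule LIMSEQ_le[OF lim2[of s] lim2[of t]]) (use that unit_onto_mono[OF p(2)] in auto)
    show "continuous_on {0..1} (\<lambda>t. 2 * t - g t)" by (intro continuous_intros g)
  qed (use unit_onto_ends[OF o1] in auto)
  have eq: "\<gamma>1 (g t) = \<gamma>2 (2 * t - g t)" if t: "t \<in> {0..1}" for t
  proof -
    have "(\<lambda>n. \<gamma>1 (p (k n) t)) \<longlonglongrightarrow> \<gamma>1 (g t)"
      by (rule continuous_on_tendsto_compose[OF _ lim[OF t]])
        (use \<gamma>(1) t unit_onto_range[OF o1] unit_onto_range[OF po] in \<open>auto simp: path_def\<close>)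
    moreover have "(\<lambda>n. \<gamma>2 (2 * t - p (k n) t)) \<longlonglongrightarrow> \<gamma>2 (2 * t - g t)"
      by (rule continuous_on_tendsto_compose[OF _ lim2[OF t]])
        (use \<gamma>(2) t unit_onto_range[OF o2, of t] unit_onto_range[OF p(2), of t] in \<open>auto simp: path_def\<close>)
    ultimately have "(\<lambda>n. \<gamma>1 (p (k n) t) - \<gamma>2 (2 * t - p (k n) t)) \<longlonglongrightarrow> \<gamma>1 (g t) - \<gamma>2 (2 * t - g t)"
      by (rule tendsto_diff)
    moreover have "(\<lambda>n. \<gamma>1 (p (k n) t) - \<gamma>2 (2 * t - p (k n) t)) \<longlonglongrightarrow> 0"
    proof (rule Lim_null_comparison)
      show "(\<lambda>n. inverse (real (Suc (k n)))) \<longlonglongrightarrow> 0"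
        using LIMSEQ_subseq_LIMSEQ[OF LIMSEQ_inverse_real_of_nat k] by (simp add: o_def)
    qed (use p(3)[OF t] in auto)
    ultimately show ?thesis using LIMSEQ_unique by fastforce
  qed
  show ?thesis by (rule that[OF o1 o2 eq])
qed

section \<open>Intervals of constancy of a path\<close>

text \<open>
  A weighted sum of the functions \<open>excursion \<gamma> a\<close> over rational \<open>a\<close> collapses exactly the
  intervals on which \<open>\<gamma>\<close> is constant.
\<close>

definition excursion :: "(real \<Rightarrow> 'a::real_normed_vector) \<Rightarrow> real \<Rightarrow> real \<Rightarrow> real" where
  "excursion \<gamma> a t = (SUP u\<in>{0..1}. dist (\<gamma> (max a (min u t))) (\<gamma> a))"

lemma path_bounded_dist:
  fixes \<gamma> :: "real \<Rightarrow> 'a::metric_space"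
  assumes "path \<gamma>"
  obtains B where "B > 0" "\<And>s t. s \<in> {0..1} \<Longrightarrow> t \<in> {0..1} \<Longrightarrow> dist (\<gamma> s) (\<gamma> t) \<le> B"
proof -
  have "bounded (\<gamma> ` {0..1})"
    using assms unfolding path_def by (intro compact_imp_bounded compact_continuous_image) auto
  then obtain B where "\<forall>x\<in>\<gamma> ` {0..1}. \<forall>y\<in>\<gamma> ` {0..1}. dist x y \<le> B"
    unfolding bounded_two_points by blast
  then show ?thesis by (intro that[of "max B 1"]) (auto simp: le_max_iff_disj)
qed

lemma excursion_le_iff:
  assumes "path \<gamma>" "a \<in> {0..1}" "t \<in> {0..1}"
  shows "excursion \<gamma> a t \<le> c \<longleftrightarrow> (\<forall>u\<in>{0..1}. dist (\<gamma> (max a (min u t))) (\<gamma> a) \<le> c)"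
proof -
  obtain B where B: "\<And>s t. s \<in> {0..1} \<Longrightarrow> t \<in> {0..1} \<Longrightarrow> dist (\<gamma> s) (\<gamma> t) \<le> B"
    using path_bounded_dist[OF assms(1)] by metis
  have "bdd_above ((\<lambda>u. dist (\<gamma> (max a (min u t))) (\<gamma> a)) ` {0..1})"
    by (rule bdd_aboveI2[where M=B], rule B) (use assms in auto)
  then show ?thesis unfolding excursion_def by (subst cSUP_le_iff) auto
qed

lemma excursion_ge:
  assumes "path \<gamma>" "a \<in> {0..1}" "t \<in> {0..1}" "u \<in> {0..1}"
  shows "dist (\<gamma> (max a (min u t))) (\<gamma> a) \<le> excursion \<gamma> a t"
  using excursion_le_iff[OF assms(1-3), of "excursion \<gamma> a t"] assms(4) by blast

lemma excursion_nonneg: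
  assumes "path \<gamma>" "a \<in> {0..1}" "t \<in> {0..1}"
  shows "0 \<le> excursion \<gamma> a t"
proof -
  have "dist (\<gamma> (max a (min 0 t))) (\<gamma> a) \<le> excursion \<gamma> a t"
    using excursion_ge[OF assms, of 0] by simp
  then show ?thesis using zero_le_dist order_trans by blast
qed

lemma excursion_mono:
  assumes "path \<gamma>" "a \<in> {0..1}" "0 \<le> s" "s \<le> t" "t \<le> 1"
  shows "excursion \<gamma> a s \<le> excursion \<gamma> a t"
proof -
  have t: "t \<in> {0..1}" "s \<in> {0..1}" using assms by auto
  have "dist (\<gamma> (max a (min u s))) (\<gamma> a) \<le> excursion \<gamma> a t" if "u \<in> {0..1}" for u
  proof -
    have "min u s \<in> {0..1}" "min (min u s) t = min u s" using that assms by auto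
    then show ?thesis using excursion_ge[OF assms(1,2) t(1), of "min u s"] by simp
  qed
  then show ?thesis using excursion_le_iff[OF assms(1,2) t(2)] by blast
qed

text \<open>The clamped point \<open>max a (min u t)\<close> runs through the interval from
  \<open>a\<close> to \<open>t\<close> and is frozen at \<open>a\<close> when \<open>t\<close> comes
  first. The supremum thus never ranges over an empty set and starts from 0.\<close>

lemma excursion_before:
  assumes "t \<le> a"
  shows "excursion \<gamma> a t = 0"
proof -
  have "max a (min u t) = a" for u using assms by auto
  then show ?thesis unfolding excursion_def by simp
qed

lemma excursion_eq_0_imp_const:
  assumes "path \<gamma>" "a \<in> {0..1}" "t \<in> {0..1}" "excursion \<gamma> a t = 0" "a \<le> u" "u \<le> t"
  shows "\<gamma> u = \<gamma> a"
proof -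
  have "u \<in> {0..1}" "max a (min u t) = u" using assms by auto
  then have "dist (\<gamma> u) (\<gamma> a) \<le> 0"
    using excursion_ge[OF assms(1-3), of u] assms(4) by simp
  then show ?thesis by simp
qed

text \<open>No new value of the path appears between \<open>s\<close> and \<open>t\<close>: a
  clamped point beyond \<open>s\<close> has the constant value, which is already taken at
  \<open>s\<close> if \<open>a \<le> s\<close> and at \<open>a\<close> otherwise.\<close>

lemma excursion_const_on:
  assumes \<gamma>: "path \<gamma>" and a: "a \<in> {0..1}" and st: "0 \<le> s" "s \<le> t" "t \<le> 1"
    and c: "\<gamma> constant_on {s..t}"
  shows "excursion \<gamma> a s = excursion \<gamma> a t"
proof (rule antisym)
  show "excursion \<gamma> a s \<le> excursion \<gamma> a t" by (rule excursion_mono[OF \<gamma> a st])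
  have s: "s \<in> {0..1}" and t: "t \<in> {0..1}" using st by auto
  obtain y where y: "\<And>x. x \<in> {s..t} \<Longrightarrow> \<gamma> x = y" using c unfolding constant_on_def by blast
  have "dist (\<gamma> (max a (min u t))) (\<gamma> a) \<le> excursion \<gamma> a s" if u: "u \<in> {0..1}" for u
  proof -
    have le: "dist (\<gamma> (max a (min u s))) (\<gamma> a) \<le> excursion \<gamma> a s"
      by (rule excursion_ge[OF \<gamma> a s u])
    have "\<gamma> (max a (min u t)) = \<gamma> (max a (min u s)) \<or> \<gamma> (max a (min u t)) = \<gamma> a"
    proof (cases "max a (min u t) \<le> s \<or> max a (min u t) = a")
      case True
      then have "max a (min u t) = max a (min u s) \<or> max a (min u t) = a" using st by linarith
      then show ?thesis by metis
    next
      case False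
      then have r: "s < u" "a < min u t" by (auto simp: max_def min_def split: if_splits)
      then have 1: "\<gamma> (max a (min u t)) = y" using y st by auto
      show ?thesis
      proof (cases "a \<le> s")
        case True
        then have "max a (min u s) = s" using r by auto
        then show ?thesis using 1 y[of s] st by simp
      next
        case False
        then have "\<gamma> a = y" using r by (intro y) auto
        then show ?thesis using 1 by simp
      qed
    qed
    then show ?thesis using le excursion_nonneg[OF \<gamma> a s] by auto
  qed
  then show "excursion \<gamma> a t \<le> excursion \<gamma> a s" using excursion_le_iff[OF \<gamma> a t] by blast
qed

text \<open>The clamped point is 1-Lipschitz in \<open>t\<close>, so uniform continuity of the path
  controls the supremum uniformly in \<open>u\<close>.\<close>

lemma continuous_on_excursion:
  assumes \<gamma>: "path \<gamma>" and a: "a \<in> {0..1}"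
  shows "continuous_on {0..1} (excursion \<gamma> a)"
  unfolding continuous_on_iff
proof (intro ballI allI impI)
  fix t e :: real assume t: "t \<in> {0..1}" and e: "0 < e"
  have "uniformly_continuous_on {0..1} \<gamma>"
    using \<gamma> unfolding path_def by (simp add: compact_uniformly_continuous)
  then obtain d where d: "d > 0"
      "\<And>s t. s \<in> {0..1} \<Longrightarrow> t \<in> {0..1} \<Longrightarrow> dist s t < d \<Longrightarrow> dist (\<gamma> s) (\<gamma> t) < e/2"
    unfolding uniformly_continuous_on_def using half_gt_zero[OF e] by metis
  have *: "excursion \<gamma> a t \<le> excursion \<gamma> a s + e/2" if s: "s \<in> {0..1}" and t: "t \<in> {0..1}" and st: "dist s t < d" for s t
  proof -
    have "dist (\<gamma> (max a (min u t))) (\<gamma> a) \<le> excursion \<gamma> a s + e/2" if u: "u \<in> {0..1}" for u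
    proof -
      have 1: "dist (\<gamma> (max a (min u s))) (\<gamma> a) \<le> excursion \<gamma> a s"
        by (rule excursion_ge[OF \<gamma> a s u])
      have 2: "dist (\<gamma> (max a (min u t))) (\<gamma> (max a (min u s))) < e/2"
        by (rule d(2)) (use u s t a st in \<open>auto simp: dist_real_def max_def min_def split: if_splits\<close>)
      show ?thesis using 1 2 dist_triangle[of "\<gamma> (max a (min u t))" "\<gamma> a" "\<gamma> (max a (min u s))"] by linarith
    qed
    then show ?thesis using excursion_le_iff[OF \<gamma> a t] by blast
  qed
  show "\<exists>d>0. \<forall>s\<in>{0..1}. dist s t < d \<longrightarrow> dist (excursion \<gamma> a s) (excursion \<gamma> a t) < e"
  proof (intro exI[of _ d] conjI ballI impI)
    fix s assume s: "s \<in> {0..1}" "dist s t < d"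
    then show "dist (excursion \<gamma> a s) (excursion \<gamma> a t) < e"
      using *[of s t] *[of t s] t e by (auto simp: dist_real_def dist_commute abs_minus_commute abs_less_iff)
  qed (rule d)
qed

text \<open>Excursions from rational points detect every movement because the path is continuous,
  and countably many of them can be summed. A nonconstant path makes the sum positive at 1, so that
  it can be normalized.\<close>

lemma monotone_constancy_parameter:
  fixes \<gamma> :: "real \<Rightarrow> 'a::real_normed_vector"
  assumes \<gamma>: "path \<gamma>" and nc: "\<not> \<gamma> constant_on {0..1}"
  obtains m where "unit_onto m"
    "\<And>s t. 0 \<le> s \<Longrightarrow> s \<le> t \<Longrightarrow> t \<le> 1 \<Longrightarrow> m s = m t \<longleftrightarrow> \<gamma> constant_on {s..t}"
proof -
  obtain B where B: "B > 0" "\<And>s t. s \<in> {0..1} \<Longrightarrow> t \<in> {0..1} \<Longrightarrow> dist (\<gamma> s) (\<gamma> t) \<le> B"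
    using path_bounded_dist[OF \<gamma>] by metis
  define q where "q = from_nat_into (\<rat> \<inter> {0..1::real})"
  have "range q = \<rat> \<inter> {0..1}"
    unfolding q_def by (rule range_from_nat_into) (auto intro!: countable_Int1 countable_rat exI[of _ 0])
  then have q01: "q k \<in> {0..1}" and qex: "\<And>a. a \<in> \<rat> \<Longrightarrow> a \<in> {0..1} \<Longrightarrow> \<exists>k. q k = a" for k
    by (auto simp: set_eq_iff image_iff) metis+
  define f where "f k t = (1/2)^k * excursion \<gamma> (q k) t" for k t
  have f0: "0 \<le> f k t" if "t \<in> {0..1}" for k t
    using excursion_nonneg[OF \<gamma> q01 that] by (simp add: f_def)
  have fB: "norm (f k t) \<le> (1/2)^k * B" if t: "t \<in> {0..1}" for k t
  proof -
    have "excursion \<gamma> (q k) t \<le> B"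
      using excursion_le_iff[OF \<gamma> q01 t] B(2) q01[of k] t by (auto simp: max_def min_def)
    then show ?thesis using f0[OF t, of k] unfolding f_def by (simp add: mult_left_mono)
  qed
  have sumB: "summable (\<lambda>k. (1/2)^k * B)"
    by (intro summable_mult2 summable_geometric) auto
  have sf: "summable (\<lambda>k. f k t)" if "t \<in> {0..1}" for t
    by (rule summable_comparison_test'[OF sumB fB[OF that]])
  define S where "S t = (\<Sum>k. f k t)" for t
  have fmono: "f k s \<le> f k t" if "0 \<le> s" "s \<le> t" "t \<le> 1" for k s t
    using excursion_mono[OF \<gamma> q01 that] unfolding f_def by (simp add: mult_left_mono)
  have Smono: "S s \<le> S t" if "0 \<le> s" "s \<le> t" "t \<le> 1" for s t
    unfolding S_def by (intro suminf_le sf fmono) (use that in auto)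
  have Scont: "continuous_on {0..1} S"
  proof -
    have "uniform_limit {0..1} (\<lambda>n x. \<Sum>i<n. f i x) S sequentially"
      unfolding S_def by (rule Weierstrass_m_test[OF fB sumB])
    moreover have "continuous_on {0..1} (\<lambda>x. \<Sum>i<n. f i x)" for n
      unfolding f_def by (intro continuous_intros continuous_on_excursion \<gamma> q01)
    ultimately show ?thesis by (intro uniform_limit_theorem) auto
  qed
  have Seq: "S s = S t \<longleftrightarrow> \<gamma> constant_on {s..t}" if st: "0 \<le> s" "s \<le> t" "t \<le> 1" for s t
  proof
    assume "\<gamma> constant_on {s..t}"
    then have "f k s = f k t" for k using excursion_const_on[OF \<gamma> q01 st] by (simp add: f_def)
    then show "S s = S t" by (simp add: S_def)
  next
    assume eq: "S s = S t"
    have sums: "summable (\<lambda>k. f k s)" "summable (\<lambda>k. f k t)" using sf st by auto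
    \<comment> \<open>All increments are nonnegative, so a vanishing sum forces each of them to
      vanish.\<close>
    have "(\<Sum>k. f k t - f k s) = 0"
      using suminf_diff[OF sums(2,1)] eq by (simp add: S_def)
    then have "f k t - f k s = 0" for k
      using suminf_eq_zero_iff[OF summable_diff[OF sums(2,1)]] fmono[OF st] by simp
    then have ex: "excursion \<gamma> (q k) t = excursion \<gamma> (q k) s" for k by (simp add: f_def)
    have same: "\<gamma> u = \<gamma> t" if u: "s < u" "u \<le> t" for u
    proof (rule ccontr)
      assume ne: "\<gamma> u \<noteq> \<gamma> t"
      \<comment> \<open>The excursion from \<open>a\<close> is still 0 at \<open>s\<close>, hence
        also at \<open>t\<close>.\<close>
      have rat: "\<gamma> a = \<gamma> t" if a: "a \<in> \<rat>" "s < a" "a \<le> t" for a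
      proof -
        obtain k where k: "q k = a" using qex[of a] a st by auto
        have "excursion \<gamma> a t = 0" using ex[of k] excursion_before[of s a] a k by simp
        then show ?thesis using excursion_eq_0_imp_const[OF \<gamma>, of a t t] a st by auto
      qed
      have "continuous (at u within {0..1}) \<gamma>"
        using \<gamma> u st unfolding path_def continuous_on_eq_continuous_within by auto
      then obtain d where d: "d > 0" "\<And>x. x \<in> {0..1} \<Longrightarrow> dist x u < d \<Longrightarrow> dist (\<gamma> x) (\<gamma> u) < dist (\<gamma> t) (\<gamma> u)"
        using ne unfolding continuous_within_eps_delta by (metis dist_commute zero_less_dist_iff)
      obtain a where a: "a \<in> \<rat>" "max s (u - d) < a" "a < u"
        using Rats_dense_in_real[of "max s (u - d)" u] u d by auto
      then show False using d(2)[of a] rat[of a] u st by (auto simp: dist_real_def)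
    qed
    \<comment> \<open>\<open>same\<close> reaches only points beyond \<open>s\<close>; the left
      endpoint follows by continuity from the right.\<close>
    have "\<gamma> s = \<gamma> t"
    proof (rule ccontr)
      assume ne: "\<gamma> s \<noteq> \<gamma> t"
      then have "s < t" using st by (cases "s = t") auto
      have "continuous (at s within {0..1}) \<gamma>"
        using \<gamma> st unfolding path_def continuous_on_eq_continuous_within by auto
      then obtain d where d: "d > 0" "\<And>x. x \<in> {0..1} \<Longrightarrow> dist x s < d \<Longrightarrow> dist (\<gamma> x) (\<gamma> s) < dist (\<gamma> t) (\<gamma> s)"
        using ne unfolding continuous_within_eps_delta by (metis dist_commute zero_less_dist_iff)
      define x where "x = min t (s + d/2)"
      have "s < x" "x \<le> t" "x \<in> {0..1}" "dist x s < d"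
        using \<open>s < t\<close> d st by (auto simp: x_def dist_real_def)
      then show False using d(2)[of x] same[of x] by simp
    qed
    then show "\<gamma> constant_on {s..t}" using same unfolding constant_on_def
      by (metis atLeastAtMost_iff order_le_less)
  qed
  have S0: "S 0 = 0"
  proof -
    have "f k 0 = 0" for k using excursion_before[of 0 "q k" \<gamma>] q01[of k] by (simp add: f_def)
    then show ?thesis by (simp add: S_def)
  qed
  have S1: "S 1 > 0" using Smono[of 0 1] Seq[of 0 1] S0 nc by force
  have "unit_onto (\<lambda>t. S t / S 1)"
  proof (rule unit_ontoI)
    show "S s / S 1 \<le> S t / S 1" if "0 \<le> s" "s \<le> t" "t \<le> 1" for s t
      using Smono[OF that] S1 by (simp add: divide_right_mono)
    show "continuous_on {0..1} (\<lambda>t. S t / S 1)"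
      using S1 by (intro continuous_intros Scont) auto
  qed (use S0 S1 in auto)
  then show ?thesis
    by (rule that) (use Seq S1 in auto)
qed

text \<open>
  The definition of the relation asks for a common quotient of the two parameter intervals. Given a
  common lift \<open>\<delta>\<close>, it is obtained by collapsing the intervals of constancy of \<open>\<delta>\<close>.
\<close>

lemma reparam_rel_of_common_lift:
  assumes \<gamma>: "path \<gamma>1" "path \<gamma>2" and p: "unit_onto p1" "unit_onto p2"
    and eq: "\<And>t. t \<in> {0..1} \<Longrightarrow> \<gamma>1 (p1 t) = \<gamma>2 (p2 t)"
  shows "(\<gamma>1, \<gamma>2) \<in> reparam_rel"
proof -
  define \<delta> where "\<delta> t = \<gamma>1 (p1 t)" for t
  have \<delta>: "path \<delta>" unfolding \<delta>_def by (rule path_comp_unit_onto[OF \<gamma>(1) p(1)])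
  show ?thesis
  \<comment> \<open>A constant lift has no normalized constancy parameter; in that case the identity
    serves as both quotient maps.\<close>
  proof (cases "\<delta> constant_on {0..1}")
    case True
    then obtain c where c: "\<And>t. t \<in> {0..1} \<Longrightarrow> \<delta> t = c" unfolding constant_on_def by blast
    have c1: "\<gamma>1 x = c" if "x \<in> {0..1}" for x
      using that c unit_onto_surj[OF p(1), of x] unfolding \<delta>_def by (metis atLeastAtMost_iff)
    have c2: "\<gamma>2 x = c" if "x \<in> {0..1}" for x
      using that c unit_onto_surj[OF p(2), of x] eq unfolding \<delta>_def by (metis atLeastAtMost_iff)
    have "constant_on_fibers \<gamma>1 (\<lambda>t. t)" "constant_on_fibers \<gamma>2 (\<lambda>t. t)"
      using c1 c2 unfolding constant_on_fibers_def constant_on_def by auto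
    moreover have "\<gamma>1 ` ({0..1} \<inter> (\<lambda>t. t) -` {s}) = \<gamma>2 ` ({0..1} \<inter> (\<lambda>t. t) -` {s})"
      if "s \<in> {0..1}" for s
      using c1 c2 by force
    ultimately show ?thesis unfolding reparam_rel_iff_unit_onto using \<gamma> unit_onto_id by blast
  next
    case False
    obtain m where m: "unit_onto m"
      and mc: "\<And>s t. 0 \<le> s \<Longrightarrow> s \<le> t \<Longrightarrow> t \<le> 1 \<Longrightarrow> m s = m t \<longleftrightarrow> \<delta> constant_on {s..t}"
      by (rule monotone_constancy_parameter[OF \<delta> False]) auto
    have const: "\<delta> s = \<delta> t" if st: "s \<in> {0..1}" "t \<in> {0..1}" "m s = m t" for s t
    proof -
      have *: "\<delta> s = \<delta> t" if "s \<le> t" "s \<in> {0..1}" "t \<in> {0..1}" "m s = m t" for s t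
      proof -
        have "\<delta> constant_on {s..t}" using mc[of s t] that by auto
        then show ?thesis using that(1) unfolding constant_on_def by force
      qed
      show ?thesis using * st by (metis linear)
    qed
    \<comment> \<open>The collapse \<open>m\<close> of the lift descends along \<open>q\<close>: the
      fibers of \<open>q\<close> are intervals on which the lift is constant, so \<open>m\<close>
      collapses them. Using the same \<open>m\<close> for both paths gives a common
      quotient.\<close>
    have *: "\<exists>n. unit_onto n \<and> constant_on_fibers \<gamma> n \<and>
               (\<forall>s\<in>{0..1}. \<gamma> ` ({0..1} \<inter> n -` {s}) = \<delta> ` ({0..1} \<inter> m -` {s}))"
      if q: "unit_onto q" and \<delta>q: "\<And>t. t \<in> {0..1} \<Longrightarrow> \<delta> t = \<gamma> (q t)" for \<gamma> q
    proof -
      define n where "n x = m (inv_into {0..1} q x)" for x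
      have qim: "q ` {0..1} = {0..1}" using q unfolding unit_onto_def by blast
      \<comment> \<open>This makes \<open>n\<close> independent of the preimage that
        \<open>inv_into\<close> selects.\<close>
      have wd: "m u = m v" if "u \<in> {0..1}" "v \<in> {0..1}" "q u = q v" "u \<le> v" for u v
      proof -
        have "q t = q u" if "t \<in> {u..v}" for t
          using unit_onto_mono[OF q, of u t] unit_onto_mono[OF q, of t v] that
            \<open>q u = q v\<close> \<open>u \<in> _\<close> \<open>v \<in> _\<close> by force
        then have "\<delta> constant_on {u..v}"
          using \<delta>q \<open>u \<in> _\<close> \<open>v \<in> _\<close> unfolding constant_on_def
          by (metis atLeastAtMost_iff order_trans)
        then show ?thesis using mc[of u v] that by auto
      qed
      have nq: "n (q u) = m u" if u: "u \<in> {0..1}" for u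
      proof -
        have "inv_into {0..1} q (q u) \<in> {0..1}" "q (inv_into {0..1} q (q u)) = q u"
          using u by (auto intro!: inv_into_into[of _ q "{0..1}", simplified] f_inv_into_f)
        then show ?thesis unfolding n_def using wd u by (metis linear)
      qed
      have "n ` {0..1} = m ` {0..1}"
      proof -
        have "n ` {0..1} = (\<lambda>t. n (q t)) ` {0..1}"
          using qim by (metis image_image)
        then show ?thesis using nq by simp
      qed
      moreover have "mono_on {0..1} n"
      proof (rule mono_onI)
        fix x y :: real assume xy: "x \<in> {0..1}" "y \<in> {0..1}" "x \<le> y"
        obtain u v where u: "u \<in> {0..1}" "q u = x" and v: "v \<in> {0..1}" "q v = y"
          using xy qim by (metis imageE)
        show "n x \<le> n y"
        proof (cases "u \<le> v")
          case True
          then show ?thesis using nq u v unit_onto_mono[OF m, of u v] by auto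
        next
          case False
          then have "x = y" using unit_onto_mono[OF q, of v u] u v xy by auto
          then show ?thesis by simp
        qed
      qed
      ultimately have "unit_onto n" using m unfolding unit_onto_def by simp
      moreover have "\<gamma> ` ({0..1} \<inter> n -` {s}) = \<delta> ` ({0..1} \<inter> m -` {s})" for s
      proof -
        have "{0..1} \<inter> n -` {s} = q ` ({0..1} \<inter> m -` {s})"
        proof
          show "q ` ({0..1} \<inter> m -` {s}) \<subseteq> {0..1} \<inter> n -` {s}" using nq qim by auto
          show "{0..1} \<inter> n -` {s} \<subseteq> q ` ({0..1} \<inter> m -` {s})"
          proof
            fix x assume x: "x \<in> {0..1} \<inter> n -` {s}"
            then obtain u where "u \<in> {0..1}" "q u = x" using qim by (metis IntE imageE)
            then show "x \<in> q ` ({0..1} \<inter> m -` {s})" using x nq by auto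
          qed
        qed
        then show ?thesis using \<delta>q by (auto simp: image_image)
      qed
      moreover have "constant_on_fibers \<gamma> n"
        unfolding constant_on_fibers_def
      proof
        fix s :: real assume "s \<in> {0..1}"
        have "\<gamma> x = \<gamma> y" if "x \<in> {0..1} \<inter> n -` {s}" "y \<in> {0..1} \<inter> n -` {s}" for x y
        proof -
          have "x \<in> q ` {0..1}" "y \<in> q ` {0..1}" using that qim by blast+
          then obtain u v where u: "u \<in> {0..1}" "q u = x" and v: "v \<in> {0..1}" "q v = y"
            by blast
          have "m u = m v" using nq[OF u(1)] nq[OF v(1)] u v that by simp
          then show ?thesis using const[OF u(1) v(1)] \<delta>q[OF u(1)] \<delta>q[OF v(1)] u v by simp
        qed
        then show "\<gamma> constant_on ({0..1} \<inter> n -` {s})" unfolding constant_on_def by blast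
      qed
      ultimately show ?thesis by blast
    qed
    obtain n1 where n1: "unit_onto n1" "constant_on_fibers \<gamma>1 n1"
       "\<forall>s\<in>{0..1}. \<gamma>1 ` ({0..1} \<inter> n1 -` {s}) = \<delta> ` ({0..1} \<inter> m -` {s})"
      using *[OF p(1), of \<gamma>1] \<delta>_def by blast
    obtain n2 where n2: "unit_onto n2" "constant_on_fibers \<gamma>2 n2"
       "\<forall>s\<in>{0..1}. \<gamma>2 ` ({0..1} \<inter> n2 -` {s}) = \<delta> ` ({0..1} \<inter> m -` {s})"
      using *[OF p(2), of \<gamma>2] \<delta>_def eq by auto
    have "\<forall>s\<in>{0..1}. \<gamma>1 ` ({0..1} \<inter> n1 -` {s}) = \<gamma>2 ` ({0..1} \<inter> n2 -` {s})"
      using n1(3) n2(3) by simp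
    then show ?thesis unfolding reparam_rel_iff_unit_onto
      by (intro conjI exI[of _ n1] exI[of _ n2] \<gamma> n1(1,2) n2(1,2))
  qed
qed

text \<open>The circle closes here: a common quotient gives distance zero, distance zero a common
  lift, and a common lift a common quotient.\<close>

lemma reparam_rel_iff_frechet_le:
  "(\<gamma>1, \<gamma>2) \<in> reparam_rel \<longleftrightarrow> path \<gamma>1 \<and> path \<gamma>2 \<and> (\<forall>e>0. frechet_le e \<gamma>1 \<gamma>2)"
proof
  assume r: "(\<gamma>1, \<gamma>2) \<in> reparam_rel"
  then show "path \<gamma>1 \<and> path \<gamma>2 \<and> (\<forall>e>0. frechet_le e \<gamma>1 \<gamma>2)"
    using reparam_rel_imp_frechet_le[OF r] by (simp add: reparam_rel_def)
next
  assume *: "path \<gamma>1 \<and> path \<gamma>2 \<and> (\<forall>e>0. frechet_le e \<gamma>1 \<gamma>2)"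
  obtain p1 p2 where "unit_onto p1" "unit_onto p2" "\<And>t. t \<in> {0..1} \<Longrightarrow> \<gamma>1 (p1 t) = \<gamma>2 (p2 t)"
    by (rule frechet_le_zero_imp_common_lift[of \<gamma>1 \<gamma>2]) (use * in auto)
  then show "(\<gamma>1, \<gamma>2) \<in> reparam_rel"
    by (rule reparam_rel_of_common_lift[rotated 2]) (use * in auto)
qed

subsection \<open>The metric on curves\<close>

text \<open>Directly, transitivity would require merging two different quotients of the middle path.
  Through Frechet distance zero it is the triangle inequality.\<close>

lemma equiv_reparam_rel: "equiv (Collect path) (reparam_rel :: ((real \<Rightarrow> 'a::real_normed_vector) \<times> _) set)"
proof (rule equivI)
  show "(reparam_rel :: ((real \<Rightarrow> 'a) \<times> _) set) \<subseteq> Collect path \<times> Collect path"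
    by (auto simp: reparam_rel_iff_frechet_le)
  show "refl_on (Collect path) (reparam_rel :: ((real \<Rightarrow> 'a) \<times> _) set)"
    by (auto intro!: refl_onI frechet_le_uniform simp: reparam_rel_iff_frechet_le)
  show "sym (reparam_rel :: ((real \<Rightarrow> 'a) \<times> _) set)"
    by (rule symI) (meson frechet_le_sym reparam_rel_iff_frechet_le)
  show "trans (reparam_rel :: ((real \<Rightarrow> 'a) \<times> _) set)"
  proof (rule transI)
    fix x y z :: "real \<Rightarrow> 'a"
    assume *: "(x, y) \<in> reparam_rel" "(y, z) \<in> reparam_rel"
    have "frechet_le e x z" if "e > 0" for e
      using frechet_le_trans[of "e/2" x y "e/2" z] * that by (auto simp: reparam_rel_iff_frechet_le)
    then show "(x, z) \<in> reparam_rel" using * by (simp add: reparam_rel_iff_frechet_le)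
  qed
qed

lemma curve_class_in_space: "path \<gamma> \<Longrightarrow> curve_class \<gamma> \<in> curve_space"
  unfolding curve_class_def curve_space_def by (auto intro: quotientI)

lemma curve_spaceE:
  assumes "c \<in> curve_space"
  obtains \<gamma> where "path \<gamma>" "c = curve_class \<gamma>"
  using assms unfolding curve_class_def curve_space_def by (auto elim: quotientE)

lemma curve_class_eq_iff:
  "path \<gamma>1 \<Longrightarrow> path \<gamma>2 \<Longrightarrow> curve_class \<gamma>1 = curve_class \<gamma>2 \<longleftrightarrow> (\<forall>e>0. frechet_le e \<gamma>1 \<gamma>2)"
  using eq_equiv_class_iff[OF equiv_reparam_rel, of \<gamma>1 \<gamma>2]
  by (simp add: curve_class_def reparam_rel_iff_frechet_le)

lemma in_curve_class_iff: "\<gamma>' \<in> curve_class \<gamma> \<longleftrightarrow> path \<gamma> \<and> path \<gamma>' \<and> (\<forall>e>0. frechet_le e \<gamma> \<gamma>')"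
  by (simp add: curve_class_def reparam_rel_iff_frechet_le)

lemma bdd_above_norm_path_diff:
  assumes "path \<gamma>1" "path \<gamma>2"
  shows "bdd_above ((\<lambda>t. norm (\<gamma>1 t - \<gamma>2 t)) ` {0..1})"
  using assms unfolding path_def
  by (intro bounded_imp_bdd_above compact_imp_bounded compact_continuous_image continuous_intros) auto

definition sup_dist :: "(real \<Rightarrow> 'a::real_normed_vector) \<Rightarrow> (real \<Rightarrow> 'a) \<Rightarrow> real" where
  "sup_dist \<gamma>1 \<gamma>2 = (SUP t\<in>{0..1}. norm (\<gamma>1 t - \<gamma>2 t))"

lemma sup_dist_upper: "path \<gamma>1 \<Longrightarrow> path \<gamma>2 \<Longrightarrow> t \<in> {0..1} \<Longrightarrow> norm (\<gamma>1 t - \<gamma>2 t) \<le> sup_dist \<gamma>1 \<gamma>2"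
  unfolding sup_dist_def by (rule cSUP_upper[OF _ bdd_above_norm_path_diff])

lemma curve_dist_eq_Inf_sup_dist:
  "path \<gamma>1 \<Longrightarrow> path \<gamma>2 \<Longrightarrow> curve_dist (curve_class \<gamma>1) (curve_class \<gamma>2) =
     Inf {sup_dist l1 l2 | l1 l2. l1 \<in> curve_class \<gamma>1 \<and> l2 \<in> curve_class \<gamma>2}"
  by (simp add: curve_dist_def curve_class_in_space sup_dist_def)

text \<open>The infimum provides representatives whose uniform distance is below \<open>e\<close>.
  Moving from the given paths to these costs arbitrarily little, and the remaining slack pays for
  it.\<close>

lemma frechet_le_of_curve_dist_less:
  assumes \<gamma>: "path \<gamma>1" "path \<gamma>2" and less: "curve_dist (curve_class \<gamma>1) (curve_class \<gamma>2) < e"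
  shows "frechet_le e \<gamma>1 \<gamma>2"
proof -
  let ?D = "{sup_dist l1 l2 | l1 l2. l1 \<in> curve_class \<gamma>1 \<and> l2 \<in> curve_class \<gamma>2}"
  have "\<gamma>1 \<in> curve_class \<gamma>1" "\<gamma>2 \<in> curve_class \<gamma>2"
    using \<gamma> by (auto simp: in_curve_class_iff intro!: frechet_le_uniform)
  then have "?D \<noteq> {}" by blast
  moreover have "Inf ?D < e" using less \<gamma> by (simp add: curve_dist_eq_Inf_sup_dist)
  ultimately have "\<exists>x\<in>?D. x < e" by (rule cInf_lessD)
  then obtain l1 l2 where l: "l1 \<in> curve_class \<gamma>1" "l2 \<in> curve_class \<gamma>2"
    and lt: "sup_dist l1 l2 < e" by blast
  define S where "S = sup_dist l1 l2"
  have pl: "path l1" "path l2" using l by (auto simp: in_curve_class_iff)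
  have "frechet_le S l1 l2"
    unfolding S_def by (intro frechet_le_uniform sup_dist_upper pl)
  \<comment> \<open>Half of the slack goes to each change of representative.\<close>
  moreover have "frechet_le ((e - S)/2) \<gamma>1 l1" "frechet_le ((e - S)/2) l2 \<gamma>2"
    using l lt frechet_le_sym[of "(e - S)/2" \<gamma>2 l2] by (simp_all add: in_curve_class_iff S_def)
  ultimately have "frechet_le ((e - S)/2 + S + (e - S)/2) \<gamma>1 \<gamma>2"
    using frechet_le_trans by blast
  moreover have "(e - S)/2 + S + (e - S)/2 = e" by simp
  ultimately show ?thesis by simp
qed

text \<open>The homeomorphism is absorbed into the representative of the second class, so its
  uniform bound is one of the candidates in the infimum.\<close>

lemma curve_dist_le_of_frechet_le:
  assumes \<gamma>: "path \<gamma>1" "path \<gamma>2" and le: "frechet_le e \<gamma>1 \<gamma>2"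
  shows "curve_dist (curve_class \<gamma>1) (curve_class \<gamma>2) \<le> e"
proof -
  let ?D = "{sup_dist l1 l2 | l1 l2. l1 \<in> curve_class \<gamma>1 \<and> l2 \<in> curve_class \<gamma>2}"
  obtain h where h: "unit_homeo h" "\<forall>t\<in>{0..1}. norm (\<gamma>1 t - \<gamma>2 (h t)) \<le> e"
    using le unfolding frechet_le_def by blast
  note o = unit_homeo_onto[OF h(1)]
  have "\<gamma>1 \<in> curve_class \<gamma>1" "(\<lambda>t. \<gamma>2 (h t)) \<in> curve_class \<gamma>2"
    using \<gamma> path_comp_unit_onto[OF \<gamma>(2) o] frechet_le_comp[OF \<gamma>(2) o, THEN frechet_le_sym]
    by (simp_all add: in_curve_class_iff frechet_le_uniform)
  then have "sup_dist \<gamma>1 (\<lambda>t. \<gamma>2 (h t)) \<in> ?D" by blast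
  moreover have "bdd_below ?D"
  proof (rule bdd_belowI[of _ 0])
    fix x assume "x \<in> ?D"
    then obtain l1 l2 where l: "l1 \<in> curve_class \<gamma>1" "l2 \<in> curve_class \<gamma>2"
      and x: "x = sup_dist l1 l2" by blast
    have "norm (l1 0 - l2 0) \<le> x"
      unfolding x by (rule sup_dist_upper) (use l in \<open>auto simp: in_curve_class_iff\<close>)
    then show "0 \<le> x" using norm_ge_zero order_trans by blast
  qed
  ultimately have "Inf ?D \<le> sup_dist \<gamma>1 (\<lambda>t. \<gamma>2 (h t))" by (rule cInf_lower)
  also have "\<dots> \<le> e" using h(2) unfolding sup_dist_def by (intro cSUP_least) auto
  finally show ?thesis using \<gamma> by (simp add: curve_dist_eq_Inf_sup_dist)
qed

lemma curve_dist_nonneg: "0 \<le> curve_dist c1 c2"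
proof (cases "c1 \<in> curve_space \<and> c2 \<in> curve_space")
  case True
  then obtain \<gamma>1 \<gamma>2 where \<gamma>: "path \<gamma>1" "path \<gamma>2" and c: "c1 = curve_class \<gamma>1" "c2 = curve_class \<gamma>2"
    by (metis curve_spaceE)
  show ?thesis
  proof (rule ccontr)
    assume neg: "\<not> 0 \<le> curve_dist c1 c2"
    \<comment> \<open>A negative number is strictly below its half, and that half is still
      negative.\<close>
    then have "frechet_le (curve_dist c1 c2 / 2) \<gamma>1 \<gamma>2"
      by (intro frechet_le_of_curve_dist_less \<gamma>) (simp add: c)
    then obtain h where "\<forall>t\<in>{0..1}. norm (\<gamma>1 t - \<gamma>2 (h t)) \<le> curve_dist c1 c2 / 2"
      unfolding frechet_le_def by blast
    then have "norm (\<gamma>1 0 - \<gamma>2 (h 0)) \<le> curve_dist c1 c2 / 2" by simp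
    then show False using neg norm_ge_zero[of "\<gamma>1 0 - \<gamma>2 (h 0)"] by linarith
  qed
qed (auto simp: curve_dist_def)

lemma curve_dist_le_commute:
  assumes "c1 \<in> curve_space" "c2 \<in> curve_space"
  shows "curve_dist c2 c1 \<le> curve_dist c1 c2"
proof -
  obtain \<gamma>1 \<gamma>2 where \<gamma>: "path \<gamma>1" "path \<gamma>2" and c: "c1 = curve_class \<gamma>1" "c2 = curve_class \<gamma>2"
    using assms by (metis curve_spaceE)
  show ?thesis
  proof (rule dense_ge)
    fix e assume "curve_dist c1 c2 < e"
    then have "frechet_le e \<gamma>2 \<gamma>1"
      using frechet_le_of_curve_dist_less[OF \<gamma>] c frechet_le_sym by blast
    then show "curve_dist c2 c1 \<le> e" using curve_dist_le_of_frechet_le \<gamma> c by blast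
  qed
qed

lemma Metric_space_curve: "Metric_space curve_space curve_dist"
proof
  fix x y :: "(real \<Rightarrow> 'a) set"
  show "0 \<le> curve_dist x y" by (rule curve_dist_nonneg)
  show "curve_dist x y = curve_dist y x"
  proof (cases "x \<in> curve_space \<and> y \<in> curve_space")
    case True
    then show ?thesis by (intro antisym curve_dist_le_commute) auto
  qed (auto simp: curve_dist_def)
next
  fix x y :: "(real \<Rightarrow> 'a) set" assume "x \<in> curve_space" "y \<in> curve_space"
  then obtain \<gamma>1 \<gamma>2 where \<gamma>: "path \<gamma>1" "path \<gamma>2" and c: "x = curve_class \<gamma>1" "y = curve_class \<gamma>2"
    by (metis curve_spaceE)
  show "curve_dist x y = 0 \<longleftrightarrow> x = y"
  proof
    assume "curve_dist x y = 0"
    then have "frechet_le e \<gamma>1 \<gamma>2" if "e > 0" for e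
      using frechet_le_of_curve_dist_less[OF \<gamma>, of e] c that by simp
    then show "x = y" using curve_class_eq_iff[OF \<gamma>] c by simp
  next
    assume "x = y"
    then have "curve_dist x y \<le> 0"
      using curve_dist_le_of_frechet_le[OF \<gamma>(1,1), of 0] c by (simp add: frechet_le_uniform)
    then show "curve_dist x y = 0" using curve_dist_nonneg[of x y] by simp
  qed
next
  fix x y z :: "(real \<Rightarrow> 'a) set" assume "x \<in> curve_space" "y \<in> curve_space" "z \<in> curve_space"
  then obtain \<gamma>1 \<gamma>2 \<gamma>3 where \<gamma>: "path \<gamma>1" "path \<gamma>2" "path \<gamma>3"
    and c: "x = curve_class \<gamma>1" "y = curve_class \<gamma>2" "z = curve_class \<gamma>3"
    by (metis curve_spaceE)
  show "curve_dist x z \<le> curve_dist x y + curve_dist y z"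
  proof (rule field_le_epsilon)
    fix e :: real assume e: "0 < e"
    have "frechet_le (curve_dist x y + e/2) \<gamma>1 \<gamma>2" "frechet_le (curve_dist y z + e/2) \<gamma>2 \<gamma>3"
      using e c by (auto intro!: frechet_le_of_curve_dist_less \<gamma>)
    from curve_dist_le_of_frechet_le[OF \<gamma>(1,3) frechet_le_trans[OF this]]
    show "curve_dist x z \<le> curve_dist x y + curve_dist y z + e" by (simp add: c)
  qed
qed

subsection \<open>Necessity\<close>

text \<open>The ambient set \<open>I\<close> is a parameter because the counting functions restrict
  the intervals to \<open>{0..<t}\<close>. For \<open>e > 0\<close> the members are nonempty, since
  the empty set has diameter 0.\<close>

definition separated_excursions :: "(real \<Rightarrow> 'a::metric_space) \<Rightarrow> real \<Rightarrow> real set \<Rightarrow> real set set \<Rightarrow> bool" where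
  "separated_excursions \<gamma> e I C \<longleftrightarrow>
     (\<forall>J\<in>C. is_interval J \<and> J \<subseteq> I \<and> diameter (\<gamma> ` J) \<ge> e) \<and> pairwise disjnt C"

lemma path_bounded_image: "path \<gamma> \<Longrightarrow> J \<subseteq> {0..1} \<Longrightarrow> bounded (\<gamma> ` J)"
  unfolding path_def
  by (rule bounded_subset[of "\<gamma> ` {0..1}"]) (auto intro!: compact_imp_bounded compact_continuous_image)

text \<open>
  Each interval of the collection contains the preimage of one of the grid points \<open>j / n\<close> under the
  homeomorphism matching \<open>\<gamma>\<close> with \<open>\<delta>\<close>, because \<open>\<delta>\<close> is uniformly continuous.
\<close>

lemma separated_excursions_near_path:
  assumes \<delta>: "path \<delta>" and e: "e > 0"
  obtains N :: nat where "\<And>\<gamma> C. path \<gamma> \<Longrightarrow> frechet_le (e/4) \<gamma> \<delta> \<Longrightarrow>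
    separated_excursions \<gamma> e {0..1} C \<Longrightarrow> finite C \<and> card C \<le> N"
proof -
  have "uniformly_continuous_on {0..1} \<delta>"
    using \<delta> unfolding path_def by (simp add: compact_uniformly_continuous)
  then obtain d where d: "d > 0"
      "\<And>s t. s \<in> {0..1} \<Longrightarrow> t \<in> {0..1} \<Longrightarrow> dist s t < d \<Longrightarrow> dist (\<delta> s) (\<delta> t) < e/4"
    unfolding uniformly_continuous_on_def using e by (metis zero_less_divide_iff zero_less_numeral)
  obtain n where n: "n > 0" "inverse (real n) < d" using ex_inverse_of_nat_less[OF d(1)] by auto
  \<comment> \<open>\<open>n + 1\<close> is the number of grid points \<open>j / n\<close> in the
    unit interval.\<close>
  have "finite C \<and> card C \<le> n + 1"
    if \<gamma>: "path \<gamma>" and le: "frechet_le (e/4) \<gamma> \<delta>" and C: "separated_excursions \<gamma> e {0..1} C" for \<gamma> C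
  proof -
    obtain h where h: "unit_homeo h" "\<forall>t\<in>{0..1}. norm (\<gamma> t - \<delta> (h t)) \<le> e/4"
      using le unfolding frechet_le_def by blast
    obtain k where k: "unit_homeo k" "\<And>t. t \<in> {0..1} \<Longrightarrow> h (k t) = t"
        "\<And>t. t \<in> {0..1} \<Longrightarrow> k (h t) = t"
      by (rule unit_homeo_inverse[OF h(1)]) auto
    have "\<exists>j\<in>{..n}. k (real j / real n) \<in> J" if J: "J \<in> C" for J
    proof -
      have J': "is_interval J" "J \<subseteq> {0..1}" "diameter (\<gamma> ` J) \<ge> e"
        using C J unfolding separated_excursions_def by auto
      \<comment> \<open>The diameter need not be attained. Beyond \<open>3/4 * e\<close>, two
        matching errors of \<open>e/4\<close> still leave more than the \<open>e/4\<close> allowed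
        by uniform continuity.\<close>
      have "\<exists>x\<in>\<gamma> ` J. \<exists>y\<in>\<gamma> ` J. 3/4 * e < dist x y"
        by (rule diameter_lower_bounded[OF path_bounded_image[OF \<gamma> J'(2)]]) (use e J'(3) in auto)
      then obtain u v where uv: "u \<in> J" "v \<in> J" "u \<le> v" "3/4 * e < dist (\<gamma> u) (\<gamma> v)"
        by (auto simp: dist_commute) (metis dist_commute linear)
      have uv01: "u \<in> {0..1}" "v \<in> {0..1}" using uv J'(2) by auto
      note huv = unit_homeo_in[OF h(1) uv01(1)] unit_homeo_in[OF h(1) uv01(2)]
      have near: "dist (\<gamma> u) (\<delta> (h u)) \<le> e/4" "dist (\<gamma> v) (\<delta> (h v)) \<le> e/4"
        using h(2) uv01 by (auto simp: dist_norm)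
      have "\<not> dist (h u) (h v) < d"
      proof
        assume "dist (h u) (h v) < d"
        then have "dist (\<delta> (h u)) (\<delta> (h v)) < e/4" using d(2) huv by blast
        then show False
          using near uv(4) dist_triangle[of "\<gamma> u" "\<gamma> v" "\<delta> (h u)"]
            dist_triangle[of "\<delta> (h u)" "\<gamma> v" "\<delta> (h v)"] dist_commute[of "\<gamma> v" "\<delta> (h v)"] by linarith
      qed
      moreover have huvle: "h u \<le> h v" using unit_homeo_le_iff[OF h(1) uv01] uv(3) by simp
      ultimately have gap: "h u + inverse (real n) < h v" using n(2) by (simp add: dist_real_def)
      \<comment> \<open>The first grid point not before \<open>h u\<close>; the gap exceeds the
        mesh, so it does not pass \<open>h v\<close>.\<close>
      define j where "j = nat \<lceil>real n * h u\<rceil>"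
      have j1: "real n * h u \<le> real j" and j2: "real j < real n * h u + 1"
        using huv(1) unfolding j_def by (auto simp: of_nat_ceiling) (smt (verit) atLeastAtMost_iff ceiling_correct mult_nonneg_nonneg of_nat_0_le_iff zero_le_ceiling of_nat_nat)
      have 1: "h u \<le> real j / real n" using j1 n(1) by (simp add: field_simps)
      have "real j / real n < h u + inverse (real n)" using j2 n(1) by (simp add: field_simps)
      then have 2: "real j / real n \<le> h v" using gap by simp
      then have jn: "real j / real n \<in> {0..1}" using huv(2) by auto
      then have "j \<le> n" using n(1) by (simp add: field_simps)
      have "u \<le> k (real j / real n)"
        using unit_homeo_le_iff[OF k(1) huv(1) jn] 1 k(3)[OF uv01(1)] by simp
      moreover have "k (real j / real n) \<le> v"
        using unit_homeo_le_iff[OF k(1) jn huv(2)] 2 k(3)[OF uv01(2)] by simp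
      ultimately have "k (real j / real n) \<in> J"
        using J'(1) uv(1,2) unfolding is_interval_1 by blast
      then show ?thesis using \<open>j \<le> n\<close> by blast
    qed
    then obtain f where f: "\<And>J. J \<in> C \<Longrightarrow> f J \<in> {..n} \<and> k (real (f J) / real n) \<in> J"
      by metis
    have "inj_on f C"
    proof (rule inj_onI)
      fix J J' assume J: "J \<in> C" "J' \<in> C" "f J = f J'"
      then have "\<not> disjnt J J'" using f[OF J(1)] f[OF J(2)] by (auto simp: disjnt_iff)
      then show "J = J'" using C J unfolding separated_excursions_def pairwise_def by blast
    qed
    moreover have "f ` C \<subseteq> {..n}" using f by blast
    ultimately show ?thesis
      using card_inj_on_le[of f C "{..n}"] inj_on_finite[of f C "{..n}"] by simp
  qed
  then show ?thesis by (rule that)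
qed

lemma compact_closure_imp:
  fixes F :: "(real \<Rightarrow> 'a::real_normed_vector) set set"
  assumes F: "F \<subseteq> curve_space" and comp: "compactin curve_topology (curve_topology closure_of F)"
  shows "bounded {\<gamma> 0 | \<gamma>. path \<gamma> \<and> curve_class \<gamma> \<in> F}"
    and "\<And>e. e > 0 \<Longrightarrow> \<exists>N. \<forall>\<gamma> C. path \<gamma> \<longrightarrow> curve_class \<gamma> \<in> F \<longrightarrow> separated_excursions \<gamma> e {0..1} C \<longrightarrow>
        finite C \<and> card C \<le> N"
proof -
  interpret Metric_space "curve_space :: (real \<Rightarrow> 'a) set set" curve_dist
    by (rule Metric_space_curve)
  have "mtotally_bounded (mtopology closure_of F)"
    using comp unfolding curve_topology_def by (rule compactin_imp_mtotally_bounded)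
  then have tb: "mtotally_bounded F"
    by (rule mtotally_bounded_subset) (use F in \<open>simp add: closure_of_subset\<close>)
  have net: "\<exists>R. finite R \<and> (\<forall>\<delta>\<in>R. path \<delta>) \<and>
      (\<forall>\<gamma>. path \<gamma> \<longrightarrow> curve_class \<gamma> \<in> F \<longrightarrow> (\<exists>\<delta>\<in>R. frechet_le e \<gamma> \<delta>))" if e: "e > 0" for e
  proof -
    obtain K where K: "finite K" "K \<subseteq> F" "F \<subseteq> (\<Union>x\<in>K. mball x e)"
      using tb[unfolded mtotally_bounded_def, rule_format, OF e] by (elim exE conjE)
    have "\<exists>\<gamma>. path \<gamma> \<and> c = curve_class \<gamma>" if "c \<in> F" for c
      using that F by (metis curve_spaceE subsetD)
    then obtain r where r: "\<And>c. c \<in> F \<Longrightarrow> path (r c) \<and> c = curve_class (r c)" by metis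
    have "\<exists>\<delta>\<in>r ` K. frechet_le e \<gamma> \<delta>" if \<gamma>: "path \<gamma>" "curve_class \<gamma> \<in> F" for \<gamma>
    proof -
      obtain c where c: "c \<in> K" "curve_class \<gamma> \<in> mball c e" using K(3) \<gamma>(2) by blast
      have rc: "path (r c)" "curve_class (r c) = c" using r c(1) K(2) by (metis subsetD)+
      have "curve_dist (curve_class \<gamma>) (curve_class (r c)) < e"
        using c(2) rc(2) by (simp add: commute)
      then show ?thesis using frechet_le_of_curve_dist_less[OF \<gamma>(1) rc(1)] c(1) by blast
    qed
    moreover have "\<forall>\<delta>\<in>r ` K. path \<delta>" using r K(2) by blast
    ultimately show ?thesis using K(1) by (intro exI[of _ "r ` K"]) blast
  qed
  show "bounded {\<gamma> 0 | \<gamma>. path \<gamma> \<and> curve_class \<gamma> \<in> F}"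
  proof -
    obtain R where R: "finite R" "\<And>\<gamma>. path \<gamma> \<Longrightarrow> curve_class \<gamma> \<in> F \<Longrightarrow> \<exists>\<delta>\<in>R. frechet_le 1 \<gamma> \<delta>"
      using net[of 1] by auto
    have "\<gamma> 0 \<in> (\<Union>\<delta>\<in>R. cball (\<delta> 0) 1)" if \<gamma>: "path \<gamma>" "curve_class \<gamma> \<in> F" for \<gamma>
    proof -
      obtain \<delta> h where \<delta>: "\<delta> \<in> R" and h: "unit_homeo h" "\<forall>t\<in>{0..1}. norm (\<gamma> t - \<delta> (h t)) \<le> 1"
        using R(2)[OF \<gamma>] unfolding frechet_le_def by blast
      \<comment> \<open>Increasing homeomorphisms fix 0, so starting points are matched with
        starting points.\<close>
      have "norm (\<gamma> 0 - \<delta> 0) \<le> 1"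
        using bspec[OF h(2), of 0] unit_onto_ends(1)[OF unit_homeo_onto[OF h(1)]] by simp
      then show ?thesis using \<delta> by (auto simp: dist_norm norm_minus_commute)
    qed
    then have "{\<gamma> 0 | \<gamma>. path \<gamma> \<and> curve_class \<gamma> \<in> F} \<subseteq> (\<Union>\<delta>\<in>R. cball (\<delta> 0) 1)" by blast
    moreover have "bounded (\<Union>\<delta>\<in>R. cball (\<delta> 0) (1::real))" by (intro bounded_UN R(1)) auto
    ultimately show ?thesis by (rule bounded_subset[rotated])
  qed
  fix e :: real assume e: "e > 0"
  obtain R where R: "finite R" "\<And>\<delta>. \<delta> \<in> R \<Longrightarrow> path \<delta>"
      "\<And>\<gamma>. path \<gamma> \<Longrightarrow> curve_class \<gamma> \<in> F \<Longrightarrow> \<exists>\<delta>\<in>R. frechet_le (e/4) \<gamma> \<delta>"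
    using net[of "e/4"] e by auto
  have "\<exists>N. \<forall>\<gamma> C. path \<gamma> \<longrightarrow> frechet_le (e/4) \<gamma> \<delta> \<longrightarrow> separated_excursions \<gamma> e {0..1} C \<longrightarrow> finite C \<and> card C \<le> N"
    if "\<delta> \<in> R" for \<delta>
    using separated_excursions_near_path[OF R(2)[OF that] e] by metis
  then obtain N where N: "\<And>\<delta> \<gamma> C. \<delta> \<in> R \<Longrightarrow> path \<gamma> \<Longrightarrow> frechet_le (e/4) \<gamma> \<delta> \<Longrightarrow> separated_excursions \<gamma> e {0..1} C \<Longrightarrow>
     finite C \<and> card C \<le> (N \<delta> :: nat)"
    by metis
  show "\<exists>N. \<forall>\<gamma> C. path \<gamma> \<longrightarrow> curve_class \<gamma> \<in> F \<longrightarrow> separated_excursions \<gamma> e {0..1} C \<longrightarrow> finite C \<and> card C \<le> N"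
  \<comment> \<open>The sum dominates each bound of the net and makes sense for an empty net
    too.\<close>
  proof (intro exI[of _ "sum N R"] allI impI)
    fix \<gamma> C assume \<gamma>: "path \<gamma>" "curve_class \<gamma> \<in> F" "separated_excursions \<gamma> e {0..1} C"
    obtain \<delta> where \<delta>: "\<delta> \<in> R" "frechet_le (e/4) \<gamma> \<delta>" using R(3)[OF \<gamma>(1,2)] by blast
    have "finite C \<and> card C \<le> N \<delta>" by (rule N[OF \<delta>(1) \<gamma>(1) \<delta>(2) \<gamma>(3)])
    moreover have "N \<delta> \<le> sum N R" using member_le_sum[of \<delta> R N] \<delta>(1) R(1) by auto
    ultimately show "finite C \<and> card C \<le> sum N R" by simp
  qed
qed

subsection \<open>Sufficiency\<close>

text \<open>
  The function \<open>T\<close> may jump; \<open>\<sigma>\<close> is its generalized inverse, which is constant across the jumps.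
\<close>

lemma monotone_inverse:
  fixes T :: "real \<Rightarrow> real"
  assumes mono: "\<And>s t. 0 \<le> s \<Longrightarrow> s < t \<Longrightarrow> t \<le> 1 \<Longrightarrow> T s < T t" and T: "T 0 = 0" "T 1 = 1"
  obtains \<sigma> where "unit_onto \<sigma>"
    "\<And>x t. x \<in> {0..1} \<Longrightarrow> t \<in> {0..1} \<Longrightarrow> t < \<sigma> x \<Longrightarrow> T t \<le> x"
    "\<And>x t. x \<in> {0..1} \<Longrightarrow> t \<in> {0..1} \<Longrightarrow> \<sigma> x < t \<Longrightarrow> x < T t"
proof -
  define A where "A x = {t\<in>{0..1}. T t \<le> x}" for x
  define \<sigma> where "\<sigma> x = Sup (A x)" for x
  have A0: "0 \<in> A x" if "x \<in> {0..1}" for x using that T by (simp add: A_def)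
  have bdd: "bdd_above (A x)" for x unfolding A_def by (rule bdd_aboveI[of _ 1]) auto
  have le: "T s \<le> T t" if "0 \<le> s" "s \<le> t" "t \<le> 1" for s t
    using mono[of s t] that by (cases "s = t") auto
  have \<sigma>01: "\<sigma> x \<in> {0..1}" if x: "x \<in> {0..1}" for x
  proof -
    have "A x \<noteq> {}" using A0[OF x] by blast
    then have "Sup (A x) \<le> 1" by (rule cSup_least) (auto simp: A_def)
    then show ?thesis using cSup_upper[OF A0[OF x] bdd] by (simp add: \<sigma>_def)
  qed
  have below: "T t \<le> x" if x: "x \<in> {0..1}" "t \<in> {0..1}" "t < \<sigma> x" for x t
  proof -
    have "A x \<noteq> {}" using A0[OF x(1)] by blast
    then obtain t' where "t' \<in> A x" "t < t'" using less_cSupD x(3) unfolding \<sigma>_def by blast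
    then show ?thesis using le[of t t'] x by (auto simp: A_def)
  qed
  have above: "x < T t" if x: "x \<in> {0..1}" "t \<in> {0..1}" "\<sigma> x < t" for x t
  proof (rule ccontr)
    assume "\<not> x < T t"
    then have "t \<in> A x" using x by (simp add: A_def)
    then show False using cSup_upper[OF _ bdd, of t x] x unfolding \<sigma>_def by simp
  qed
  have "unit_onto \<sigma>"
    unfolding unit_onto_def
  proof
    show "mono_on {0..1} \<sigma>"
    proof (rule mono_onI)
      fix x y :: real assume xy: "x \<in> {0..1}" "y \<in> {0..1}" "x \<le> y"
      show "\<sigma> x \<le> \<sigma> y"
        unfolding \<sigma>_def
      proof (rule cSup_subset_mono[OF _ bdd])
        show "A x \<noteq> {}" using A0[OF xy(1)] by blast
        show "A x \<subseteq> A y" using xy(3) by (auto simp: A_def)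
      qed
    qed
    show "\<sigma> ` {0..1} = {0..1}"
    proof
      show "\<sigma> ` {0..1} \<subseteq> {0..1}" using \<sigma>01 by blast
      show "{0..1} \<subseteq> \<sigma> ` {0..1}"
      proof
        fix t :: real assume t: "t \<in> {0..1}"
        \<comment> \<open>Strict monotonicity of \<open>T\<close> enters here. It makes
          \<open>\<sigma>\<close> a left inverse of \<open>T\<close>, hence onto and so free of
          jumps.\<close>
        have "A (T t) = {0..t}"
        proof
          show "{0..t} \<subseteq> A (T t)" using t le by (auto simp: A_def)
          show "A (T t) \<subseteq> {0..t}"
          proof
            fix s assume "s \<in> A (T t)"
            then show "s \<in> {0..t}" using mono[of t s] t by (auto simp: A_def not_less[symmetric])
          qed
        qed
        then have "\<sigma> (T t) = t" using t by (simp add: \<sigma>_def)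
        moreover have "T t \<in> {0..1}" using le[of 0 t] le[of t 1] T t by auto
        ultimately show "t \<in> \<sigma> ` {0..1}" by (metis imageI)
      qed
    qed
  qed
  then show ?thesis by (rule that[OF _ below above])
qed

section \<open>Counting disjoint large oscillations\<close>

text \<open>The right end is left open so that a closed interval starting at \<open>t\<close> is
  disjoint from everything counted at \<open>t\<close>. \<open>Max\<close> is meaningful once the
  cardinalities are bounded, as in the context below.\<close>

definition excursion_count :: "(real \<Rightarrow> 'a::metric_space) \<Rightarrow> real \<Rightarrow> real \<Rightarrow> nat" where
  "excursion_count \<gamma> e t = Max (card ` {C. separated_excursions \<gamma> e {0..<t} C})"

lemma separated_excursions_subset:
  "separated_excursions \<gamma> e I C \<Longrightarrow> I \<subseteq> I' \<Longrightarrow> separated_excursions \<gamma> e I' C"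
  unfolding separated_excursions_def by blast

context
  fixes \<gamma> :: "real \<Rightarrow> 'a::metric_space" and e :: real and N :: nat
  assumes e: "e > 0" and path: "path \<gamma>"
    and N: "\<And>C. separated_excursions \<gamma> e {0..1} C \<Longrightarrow> finite C \<and> card C \<le> N"
begin

lemma excursion_count_bounded:
  assumes "t \<le> 1" "separated_excursions \<gamma> e {0..<t} C"
  shows "finite C" "card C \<le> N"
proof -
  have "{0..<t} \<subseteq> {0..1}" using assms(1) by auto
  then show "finite C" "card C \<le> N" using N separated_excursions_subset[OF assms(2)] by auto
qed

lemma finite_excursion_cards: "t \<le> 1 \<Longrightarrow> finite (card ` {C. separated_excursions \<gamma> e {0..<t} C})"
  by (rule finite_subset[of _ "{..N}"]) (auto dest: excursion_count_bounded)

lemma excursion_count_ge: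
  "t \<le> 1 \<Longrightarrow> separated_excursions \<gamma> e {0..<t} C \<Longrightarrow> card C \<le> excursion_count \<gamma> e t"
  unfolding excursion_count_def by (rule Max_ge[OF finite_excursion_cards]) auto

lemma excursion_count_attained:
  assumes "t \<le> 1"
  obtains C where "separated_excursions \<gamma> e {0..<t} C" "card C = excursion_count \<gamma> e t"
proof -
  have "separated_excursions \<gamma> e {0..<t} {}" by (simp add: separated_excursions_def)
  then have "excursion_count \<gamma> e t \<in> card ` {C. separated_excursions \<gamma> e {0..<t} C}"
    unfolding excursion_count_def by (intro Max_in finite_excursion_cards assms) auto
  then show ?thesis using that by auto
qed

lemma excursion_count_le: "t \<le> 1 \<Longrightarrow> excursion_count \<gamma> e t \<le> N"
  by (metis excursion_count_attained excursion_count_bounded(2))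

lemma excursion_count_mono: "s \<le> t \<Longrightarrow> t \<le> 1 \<Longrightarrow> excursion_count \<gamma> e s \<le> excursion_count \<gamma> e t"
proof -
  assume st: "s \<le> t" "t \<le> 1"
  then have "s \<le> 1" by simp
  then obtain C where C: "separated_excursions \<gamma> e {0..<s} C" "card C = excursion_count \<gamma> e s"
    by (rule excursion_count_attained)
  have "separated_excursions \<gamma> e {0..<t} C"
    by (rule separated_excursions_subset[OF C(1)]) (use st in auto)
  then show ?thesis using excursion_count_ge[OF st(2)] C(2) by metis
qed

text \<open>An optimal collection before \<open>s\<close> can be enlarged by \<open>{s..t}\<close>
  itself. The strict inequality \<open>t < u\<close> lets the count at \<open>u\<close> see its
  right endpoint.\<close>

lemma excursion_count_increases:
  assumes st: "0 \<le> s" "s \<le> t" "t < u" "u \<le> 1" and far: "e \<le> dist (\<gamma> s) (\<gamma> t)"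
  shows "excursion_count \<gamma> e s + 1 \<le> excursion_count \<gamma> e u"
proof -
  have s1: "s \<le> 1" using st by simp
  obtain C where C: "separated_excursions \<gamma> e {0..<s} C" "card C = excursion_count \<gamma> e s"
    by (rule excursion_count_attained[OF s1])
  have "bounded (\<gamma> ` {s..t})"
    by (rule path_bounded_image[OF path]) (use st in auto)
  then have "dist (\<gamma> s) (\<gamma> t) \<le> diameter (\<gamma> ` {s..t})"
    by (rule diameter_bounded_bound) (use st in auto)
  then have diam: "e \<le> diameter (\<gamma> ` {s..t})" using far by simp
  have disj: "disjnt {s..t} J" if "J \<in> C" for J
  proof -
    have "J \<subseteq> {0..<s}" using C(1) that unfolding separated_excursions_def by blast
    then show ?thesis by (auto simp: disjnt_iff)
  qed
  have "{s..t} \<notin> C"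
  proof
    assume "{s..t} \<in> C"
    then have "{s..t} \<subseteq> {0..<s}" using C(1) unfolding separated_excursions_def by blast
    moreover have "s \<in> {s..t}" using st by simp
    ultimately show False by auto
  qed
  then have "card (insert {s..t} C) = excursion_count \<gamma> e s + 1"
    using C excursion_count_bounded(1)[OF s1 C(1)] by simp
  moreover have "separated_excursions \<gamma> e {0..<u} (insert {s..t} C)"
  proof -
    have "separated_excursions \<gamma> e {0..<u} C"
      by (rule separated_excursions_subset[OF C(1)]) (use st in auto)
    moreover have "pairwise disjnt (insert {s..t} C)"
      using C(1) disj unfolding separated_excursions_def pairwise_insert by (metis disjnt_sym)
    moreover have "{s..t} \<subseteq> {0..<u}" using st by auto
    ultimately show ?thesis
      using diam unfolding separated_excursions_def by (simp add: is_interval_cc)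
  qed
  ultimately show ?thesis using excursion_count_ge[OF st(4)] by metis
qed

end

section \<open>Representatives with a common modulus of continuity\<close>

text \<open>The modulus depends on the path only through the bounds \<open>N k\<close>. A growth of
  the count by one adds \<open>(1/2)^(Suc k) / N k\<close> to the weighted sum, and normalization to
  total length one costs at most another factor 2.\<close>

lemma controlled_reparametrization:
  fixes \<gamma> :: "real \<Rightarrow> 'a::real_normed_vector" and N :: "nat \<Rightarrow> nat"
  assumes \<gamma>: "path \<gamma>" and Npos: "\<And>k. N k > 0"
    and N: "\<And>k C. separated_excursions \<gamma> ((1/2)^k) {0..1} C \<Longrightarrow> finite C \<and> card C \<le> N k"
  shows "\<exists>\<sigma>. unit_onto \<sigma> \<and>
    (\<forall>k. \<forall>x\<in>{0..1}. \<forall>y\<in>{0..1}. \<bar>x - y\<bar> < (1/2)^(k+2) / real (N k) \<longrightarrow>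
        norm (\<gamma> (\<sigma> x) - \<gamma> (\<sigma> y)) \<le> (1/2)^k)"
proof -
  define \<tau> where "\<tau> k t = real (excursion_count \<gamma> ((1/2)^k) t)" for k t
  have p: "(0::real) < (1/2)^k" for k :: nat by simp
  have \<tau>_le: "\<tau> k t \<le> N k" if "t \<le> 1" for k t
    unfolding \<tau>_def of_nat_le_iff by (rule excursion_count_le[OF p \<gamma> N that])
  have \<tau>_mono: "\<tau> k s \<le> \<tau> k t" if "s \<le> t" "t \<le> 1" for k s t
    unfolding \<tau>_def of_nat_le_iff by (rule excursion_count_mono[OF p \<gamma> N that])
  have \<tau>_inc: "\<tau> k s + 1 \<le> \<tau> k u"
    if "0 \<le> s" "s \<le> t" "t < u" "u \<le> 1" "(1/2)^k \<le> dist (\<gamma> s) (\<gamma> t)" for k s t u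
  proof -
    have "excursion_count \<gamma> ((1/2)^k) s + 1 \<le> excursion_count \<gamma> ((1/2)^k) u"
      by (rule excursion_count_increases[OF p \<gamma> N that])
    then show ?thesis unfolding \<tau>_def by linarith
  qed
  \<comment> \<open>Division by \<open>N k\<close> keeps each term below its weight, and the weights
    sum to 1.\<close>
  define f where "f k t = (1/2)^(Suc k) * (\<tau> k t / N k)" for k t
  have f0: "0 \<le> f k t" for k t by (simp add: f_def \<tau>_def)
  have f1: "f k t \<le> (1/2)^(Suc k)" if "t \<le> 1" for k t
    unfolding f_def using \<tau>_le[OF that, of k] Npos[of k] by (intro mult_left_le) (auto simp: field_simps)
  have sumf: "summable (\<lambda>k. f k t)" if "t \<le> 1" for t
    by (rule summable_comparison_test'[of "\<lambda>k. (1/2)^(Suc k)" 0])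
      (use f0 f1[OF that] in \<open>auto intro: summable_mult summable_geometric\<close>)
  have fmono: "f k s \<le> f k t" if "s \<le> t" "t \<le> 1" for k s t
    unfolding f_def using \<tau>_mono[OF that] by (intro mult_left_mono divide_right_mono) auto
  define S where "S t = (\<Sum>k. f k t)" for t
  have S0: "0 \<le> S t" if "t \<le> 1" for t
    unfolding S_def by (rule suminf_nonneg[OF sumf[OF that] f0])
  have S1: "S t \<le> 1" if "t \<le> 1" for t
  proof -
    have "(\<lambda>k. (1/2)^(Suc k)) sums (1::real)" by (rule power_half_series)
    then show ?thesis
      unfolding S_def using suminf_le[OF f1[OF that] sumf[OF that]] by (simp add: sums_iff)
  qed
  have S_inc: "f k t - f k s \<le> S t - S s" if "s \<le> t" "t \<le> 1" for k s t
  proof -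
    have sm: "summable (\<lambda>k. f k t)" "summable (\<lambda>k. f k s)" using sumf that by auto
    have "S t - S s = (\<Sum>k. f k t - f k s)" unfolding S_def by (rule suminf_diff[OF sm])
    moreover have "sum (\<lambda>k. f k t - f k s) {k} \<le> (\<Sum>k. f k t - f k s)"
      by (rule sum_le_suminf[OF summable_diff[OF sm]]) (use fmono[OF that] in auto)
    ultimately show ?thesis by simp
  qed
  have Smono: "S s \<le> S t" if "s \<le> t" "t \<le> 1" for s t
    using S_inc[OF that, of 0] fmono[OF that, of 0] by simp
  define L where "L = 1 + S 1 - S 0"
  have L: "1 \<le> L" "L \<le> 2" using Smono[of 0 1] S1[of 1] S0[of 0] by (auto simp: L_def)
  define T where "T t = (t + S t - S 0) / L" for t
  have Tmono: "T s < T t" if "0 \<le> s" "s < t" "t \<le> 1" for s t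
    unfolding T_def using Smono[of s t] that L by (intro divide_strict_right_mono) auto
  have T01: "T 0 = 0" "T 1 = 1" using L by (auto simp: T_def L_def)
  have T_inc: "(1/2)^(k+2) / N k \<le> T u - T s"
    if "0 \<le> s" "s \<le> t" "t < u" "u \<le> 1" "(1/2)^k \<le> dist (\<gamma> s) (\<gamma> t)" for k s t u
  proof -
    have "(1/2)^(Suc k) * ((\<tau> k s + 1) / N k) \<le> f k u"
      unfolding f_def using \<tau>_inc[OF that] by (intro mult_left_mono divide_right_mono) auto
    then have "(1/2)^(Suc k) / N k \<le> f k u - f k s"
      by (simp add: f_def add_divide_distrib algebra_simps)
    also have "\<dots> \<le> S u - S s" by (rule S_inc) (use that in auto)
    also have "\<dots> \<le> L * (T u - T s)"
      using that L by (simp add: T_def diff_divide_distrib [symmetric])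
    also have "\<dots> \<le> 2 * (T u - T s)"
      using Tmono[of s u] that L by (intro mult_right_mono) auto
    finally show ?thesis by (simp add: field_simps)
  qed
  obtain \<sigma> where \<sigma>: "unit_onto \<sigma>"
    "\<And>x t. x \<in> {0..1} \<Longrightarrow> t \<in> {0..1} \<Longrightarrow> t < \<sigma> x \<Longrightarrow> T t \<le> x"
    "\<And>x t. x \<in> {0..1} \<Longrightarrow> t \<in> {0..1} \<Longrightarrow> \<sigma> x < t \<Longrightarrow> x < T t"
    using monotone_inverse[of T, OF Tmono T01] by blast
  have main: "norm (\<gamma> (\<sigma> x) - \<gamma> (\<sigma> y)) \<le> (1/2)^k"
    if xy: "x \<in> {0..1}" "y \<in> {0..1}" "x \<le> y" "y - x < (1/2)^(k+2) / N k" for x y k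
  proof (rule ccontr)
    assume "\<not> norm (\<gamma> (\<sigma> x) - \<gamma> (\<sigma> y)) \<le> (1/2)^k"
    then have far: "dist (\<gamma> (\<sigma> x)) (\<gamma> (\<sigma> y)) > (1/2)^k" by (simp add: dist_norm)
    define s t where "s = \<sigma> x" and "t = \<sigma> y"
    have s: "0 \<le> s" "s \<le> 1" and t: "0 \<le> t" "t \<le> 1"
      using unit_onto_range[OF \<sigma>(1)] xy by (auto simp: s_def t_def)
    have st: "s < t"
      using unit_onto_mono[OF \<sigma>(1), of x y] xy far p[of k] by (cases "s = t") (auto simp: s_def t_def)
    \<comment> \<open>\<open>r\<close> is the excess over the threshold. The inequalities for
      \<open>\<sigma>\<close> hold only strictly on either side of its value, so the endpoints are
      moved inward to \<open>a\<close> and \<open>b\<close>, losing less than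
      \<open>r\<close>.\<close>
    define r where "r = dist (\<gamma> s) (\<gamma> t) - (1/2)^k"
    have r: "r > 0" using far by (simp add: r_def s_def t_def)
    have "uniformly_continuous_on {0..1} \<gamma>"
      using \<gamma> unfolding path_def by (simp add: compact_uniformly_continuous)
    then obtain d where d: "d > 0"
        "\<And>a b. a \<in> {0..1} \<Longrightarrow> b \<in> {0..1} \<Longrightarrow> dist a b < d \<Longrightarrow> dist (\<gamma> a) (\<gamma> b) < r/2"
      unfolding uniformly_continuous_on_def using half_gt_zero[OF r] by metis
    define \<eta> where "\<eta> = min (d/2) ((t - s)/4)"
    have \<eta>: "0 < \<eta>" "\<eta> < d" "4 * \<eta> \<le> t - s" using d(1) st by (auto simp: \<eta>_def min_def)
    define a b where "a = s + \<eta>" and "b = t - \<eta>"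
    have ab: "s < a" "a < b" "b < t" using \<eta> by (auto simp: a_def b_def)
    have "dist (\<gamma> s) (\<gamma> a) < r/2" "dist (\<gamma> b) (\<gamma> t) < r/2"
      by (rule d(2); use \<eta> s t ab in \<open>simp add: a_def b_def dist_real_def\<close>)+
    then have "dist (\<gamma> s) (\<gamma> t) - r < dist (\<gamma> a) (\<gamma> b)"
      using dist_triangle[of "\<gamma> s" "\<gamma> t" "\<gamma> a"] dist_triangle[of "\<gamma> a" "\<gamma> t" "\<gamma> b"]
      by linarith
    then have "(1/2)^k \<le> dist (\<gamma> a) (\<gamma> b)" by (simp add: r_def)
    \<comment> \<open>The midpoint lies beyond \<open>b\<close>, so that the count sees
      \<open>{a..b}\<close>, and before \<open>t\<close>, so that \<open>T\<close> is at most
      \<open>y\<close> there.\<close>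
    then have "(1/2)^(k+2) / N k \<le> T ((b + t)/2) - T a"
      by (intro T_inc[of a b "(b+t)/2"]) (use ab s t in auto)
    moreover have "x < T a" by (rule \<sigma>(3)) (use ab s t xy in \<open>auto simp: s_def\<close>)
    moreover have "T ((b + t)/2) \<le> y" by (rule \<sigma>(2)) (use ab s t xy in \<open>auto simp: t_def\<close>)
    ultimately show False using xy(4) by linarith
  qed
  show ?thesis
  proof (intro exI[of _ \<sigma>] conjI \<sigma>(1) allI ballI impI)
    fix k x y assume "x \<in> {0..1}" "y \<in> {0..1}" "\<bar>x - y\<bar> < (1/2)^(k+2) / real (N k)"
    then show "norm (\<gamma> (\<sigma> x) - \<gamma> (\<sigma> y)) \<le> (1/2)^k"
      using main[of x y k] main[of y x k] by (cases "x \<le> y") (auto simp: norm_minus_commute)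
  qed
qed

section \<open>Extraction of convergent sequences of curves\<close>

text \<open>The Bolzano-Weierstrass criterion tests the closure on infinite subsets of
  \<open>F\<close> itself, so controlled representatives are required for curves of \<open>F\<close>
  alone, not for limit curves. The Heine-Borel property of the target enters through
  Arzela-Ascoli.\<close>

lemma compact_closure_if:
  fixes F :: "(real \<Rightarrow> 'a::{real_normed_vector,heine_borel}) set set"
  assumes F: "F \<subseteq> curve_space" and bdd: "bounded {\<gamma> 0 | \<gamma>. path \<gamma> \<and> curve_class \<gamma> \<in> F}"
    and N: "\<And>e. e > 0 \<Longrightarrow> \<exists>N>0. \<forall>\<gamma> C. path \<gamma> \<longrightarrow> curve_class \<gamma> \<in> F \<longrightarrow> separated_excursions \<gamma> e {0..1} C \<longrightarrow>
        finite C \<and> card C \<le> N"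
  shows "compactin curve_topology (curve_topology closure_of F)"
proof -
  interpret Metric_space "curve_space :: (real \<Rightarrow> 'a) set set" curve_dist
    by (rule Metric_space_curve)
  have "\<exists>N>0. \<forall>\<gamma> C. path \<gamma> \<longrightarrow> curve_class \<gamma> \<in> F \<longrightarrow> separated_excursions \<gamma> ((1/2)^k) {0..1} C \<longrightarrow>
        finite C \<and> card C \<le> N" for k :: nat
    by (rule N) simp
  then obtain N where Npos: "\<And>k. N k > 0" and
    N: "\<And>k \<gamma> C. path \<gamma> \<Longrightarrow> curve_class \<gamma> \<in> F \<Longrightarrow> separated_excursions \<gamma> ((1/2)^k) {0..1} C \<Longrightarrow>
        finite C \<and> card C \<le> (N k :: nat)" by metis
  define \<delta> where "\<delta> k = (1/2)^(k+2) / real (N k)" for k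
  have \<delta>: "\<delta> k > 0" for k using Npos[of k] by (simp add: \<delta>_def)
  obtain B where B: "\<And>\<gamma>. path \<gamma> \<Longrightarrow> curve_class \<gamma> \<in> F \<Longrightarrow> norm (\<gamma> 0) \<le> B"
    using bdd unfolding bounded_iff by blast
  have rep: "\<exists>g. path g \<and> curve_class g = c \<and>
      (\<forall>k. \<forall>x\<in>{0..1}. \<forall>y\<in>{0..1}. \<bar>x - y\<bar> < \<delta> k \<longrightarrow> norm (g x - g y) \<le> (1/2)^k)" if c: "c \<in> F" for c
  proof -
    obtain \<gamma> where \<gamma>: "path \<gamma>" "c = curve_class \<gamma>" using c F by (meson curve_spaceE subsetD)
    have cF: "curve_class \<gamma> \<in> F" using c \<gamma> by simp
    have "\<exists>\<sigma>. unit_onto \<sigma> \<and>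
      (\<forall>k. \<forall>x\<in>{0..1}. \<forall>y\<in>{0..1}. \<bar>x - y\<bar> < \<delta> k \<longrightarrow> norm (\<gamma> (\<sigma> x) - \<gamma> (\<sigma> y)) \<le> (1/2)^k)"
      unfolding \<delta>_def by (rule controlled_reparametrization[OF \<gamma>(1) Npos N[OF \<gamma>(1) cF]])
    then obtain \<sigma> where \<sigma>: "unit_onto \<sigma>"
      "\<forall>k. \<forall>x\<in>{0..1}. \<forall>y\<in>{0..1}. \<bar>x - y\<bar> < \<delta> k \<longrightarrow> norm (\<gamma> (\<sigma> x) - \<gamma> (\<sigma> y)) \<le> (1/2)^k"
      by blast
    have pg: "path (\<lambda>t. \<gamma> (\<sigma> t))" by (rule path_comp_unit_onto[OF \<gamma>(1) \<sigma>(1)])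
    have "curve_class (\<lambda>t. \<gamma> (\<sigma> t)) = c"
      using curve_class_eq_iff[OF pg \<gamma>(1)] frechet_le_comp[OF \<gamma>(1) \<sigma>(1)] \<gamma>(2) by simp
    then show ?thesis using pg \<sigma>(2) by (intro exI[of _ "\<lambda>t. \<gamma> (\<sigma> t)"]) simp
  qed
  show ?thesis
    unfolding curve_topology_def compact_closure_of_eq_Bolzano_Weierstrass
  proof (intro allI impI)
    fix S assume S: "infinite S \<and> S \<subseteq> F \<and> S \<subseteq> curve_space"
    then obtain c :: "nat \<Rightarrow> _" where c: "inj c" "range c \<subseteq> S" using infinite_countable_subset by metis
    have cF: "c n \<in> F" for n using c(2) S by blast
    have "\<forall>n. \<exists>g. path g \<and> curve_class g = c n \<and>
      (\<forall>k. \<forall>x\<in>{0..1}. \<forall>y\<in>{0..1}. \<bar>x - y\<bar> < \<delta> k \<longrightarrow> norm (g x - g y) \<le> (1/2)^k)"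
      using rep[OF cF] by blast
    then obtain g where g: "\<And>n. path (g n)" "\<And>n. curve_class (g n) = c n"
      "\<And>n k x y. x \<in> {0..1} \<Longrightarrow> y \<in> {0..1} \<Longrightarrow> \<bar>x - y\<bar> < \<delta> k \<Longrightarrow> norm (g n x - g n y) \<le> (1/2)^k"
      by metis
    obtain n0 where n0: "n0 > 0" "inverse (real n0) < \<delta> 0" using ex_inverse_of_nat_less[OF \<delta>] by auto
    \<comment> \<open>Walking from 0 to \<open>x\<close> in \<open>n0\<close> equal steps, each
      shorter than \<open>\<delta> 0\<close>, moves the path by at most 1 per step. The starting
      point is bounded by \<open>B\<close>.\<close>
    have bound: "norm (g n x) \<le> B + real n0" if x: "x \<in> {0..1}" for n x
    proof -
      have steps: "norm (g n (x * real i / real n0) - g n 0) \<le> real i" if "i \<le> n0" for i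
        using that
      proof (induction i)
        case (Suc i)
        have in01: "x * real j / real n0 \<in> {0..1}" if "j \<le> n0" for j
          using that x n0(1) by (auto simp: divide_le_eq_1 intro: mult_le_one order_trans[OF mult_left_le_one_le])
        have "\<bar>x * real (Suc i) / real n0 - x * real i / real n0\<bar> = x * inverse (real n0)"
        proof -
          have "x * real (Suc i) / real n0 - x * real i / real n0 = x * inverse (real n0)"
            by (simp add: divide_inverse algebra_simps)
          then show ?thesis using x by simp
        qed
        also have "\<dots> \<le> inverse (real n0)" using x by (simp add: mult_left_le_one_le)
        finally have "norm (g n (x * real (Suc i) / real n0) - g n (x * real i / real n0)) \<le> (1/2)^0"
          using n0(2) Suc.prems by (intro g(3) in01) auto
        moreover have "norm (g n (x * real i / real n0) - g n 0) \<le> real i" using Suc by simp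
        ultimately show ?case
          using norm_triangle_ineq[of "g n (x * real (Suc i) / real n0) - g n (x * real i / real n0)" "g n (x * real i / real n0) - g n 0"]
          by simp
      qed simp
      have "norm (g n x - g n 0) \<le> real n0" using steps[of n0] n0(1) by simp
      moreover have "norm (g n 0) \<le> B" using B[OF g(1)] g(2) cF by simp
      ultimately show ?thesis using norm_triangle_ineq[of "g n x - g n 0" "g n 0"] by simp
    qed
    obtain G r where G: "continuous_on {0..1} G" and r: "strict_mono (r :: nat \<Rightarrow> nat)"
      and unif: "\<And>e. 0 < e \<Longrightarrow> \<exists>N. \<forall>n x. n \<ge> N \<and> x \<in> {0..1} \<longrightarrow> norm (g (r n) x - G x) < e"
    proof (rule Arzela_Ascoli[of "{0..1::real}" g "B + real n0"])
      show "norm (g n x) \<le> B + real n0" if "x \<in> {0..1}" for n x by (rule bound[OF that])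
      show "\<exists>d>0. \<forall>n y. y \<in> {0..1} \<and> norm (x - y) < d \<longrightarrow> norm (g n x - g n y) < e"
        if "x \<in> {0..1}" "0 < e" for x e
      proof -
        obtain k where k: "(1/2)^k < e" using real_arch_pow_inv[OF \<open>0 < e\<close>, of "1/2"] by auto
        have "norm (g n x - g n y) < e" if "y \<in> {0..1}" "norm (x - y) < \<delta> k" for n y
          using g(3)[OF \<open>x \<in> _\<close> that(1), of k n] that(2) k by simp
        then show ?thesis using \<delta>[of k] by blast
      qed
    qed auto
    have pG: "path G" using G by (simp add: path_def)
    have "curve_class G \<in> mtopology derived_set_of S"
      unfolding metric_derived_set_of
    proof (intro CollectI conjI allI impI)
      show "curve_class G \<in> curve_space" by (rule curve_class_in_space[OF pG])
      fix e :: real assume e: "0 < e"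
      obtain M where M: "\<And>n x. n \<ge> M \<Longrightarrow> x \<in> {0..1} \<Longrightarrow> norm (g (r n) x - G x) < e/2"
        using unif[of "e/2"] e by auto
      have near: "c (r n) \<in> mball (curve_class G) e" if "n \<ge> M" for n
      proof -
        have "frechet_le (e/2) (g (r n)) G"
          by (intro frechet_le_uniform less_imp_le M that)
        then have "curve_dist (c (r n)) (curve_class G) \<le> e/2"
          using curve_dist_le_of_frechet_le[OF g(1) pG] g(2) by metis
        then show ?thesis
          using e curve_class_in_space[OF pG] curve_class_in_space[OF g(1), of "r n"] g(2)
          by (simp add: commute)
      qed
      \<comment> \<open>An accumulation point needs members of \<open>S\<close> other than itself;
        of two distinct curves at most one can be the limit.\<close>
      have "c (r M) \<noteq> c (r (Suc M))"
        using c(1) r by (metis injD n_not_Suc_n strict_mono_eq)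
      then obtain n where "n \<ge> M" "c (r n) \<noteq> curve_class G" by (metis le_SucI order_refl)
      then show "\<exists>y\<in>S. y \<noteq> curve_class G \<and> y \<in> mball (curve_class G) e"
        using near c(2) by blast
    qed
    then show "mtopology derived_set_of S \<noteq> {}" by blast
  qed
qed

theorem theorem13:
  fixes F :: "(real \<Rightarrow> real ^ 'n) set set"
  assumes "CARD('n) \<ge> 2"
    and "F \<subseteq> curve_space"
  shows "compactin curve_topology (curve_topology closure_of F) \<longleftrightarrow>
    bounded {\<gamma> 0 | \<gamma>. path \<gamma> \<and> curve_class \<gamma> \<in> F} \<and>
    (\<forall>\<epsilon>>0. \<exists>N::nat. N > 0 \<and>
      (\<forall>\<gamma>. path \<gamma> \<and> curve_class \<gamma> \<in> F \<longrightarrow>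
        \<not> (\<exists>C :: real set set.
              (\<forall>J\<in>C. is_interval J \<and> J \<subseteq> {0..1} \<and> diameter (\<gamma> ` J) \<ge> \<epsilon>) \<and>
              pairwise disjnt C \<and> (infinite C \<or> card C > N))))"
    (is "?compact \<longleftrightarrow> ?bounded \<and> (\<forall>\<epsilon>>0. ?few \<epsilon>)")
proof -
  \<comment> \<open>\<open>card\<close> is 0 on infinite sets, so exceeding \<open>N\<close>
    includes the infinite collections explicitly; its negation is finiteness together with the
    bound.\<close>
  have few: "?few \<epsilon> \<longleftrightarrow> (\<exists>N>0. \<forall>\<gamma> C. path \<gamma> \<longrightarrow> curve_class \<gamma> \<in> F \<longrightarrow>
      separated_excursions \<gamma> \<epsilon> {0..1} C \<longrightarrow> finite C \<and> card C \<le> N)" for \<epsilon>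
  proof -
    have "\<not> (\<exists>C. (\<forall>J\<in>C. is_interval J \<and> J \<subseteq> {0..1} \<and> diameter (\<gamma> ` J) \<ge> \<epsilon>) \<and>
              pairwise disjnt C \<and> (infinite C \<or> card C > N)) \<longleftrightarrow>
      (\<forall>C. separated_excursions \<gamma> \<epsilon> {0..1} C \<longrightarrow> finite C \<and> card C \<le> N)" for \<gamma> :: "real \<Rightarrow> real ^ 'n" and N
      unfolding separated_excursions_def not_le[symmetric] by meson
    then show ?thesis by (simp only: imp_conjL all_simps)
  qed
  show ?thesis
  proof
    assume c: ?compact
    have "\<exists>N>0. \<forall>\<gamma> C. path \<gamma> \<longrightarrow> curve_class \<gamma> \<in> F \<longrightarrow>
      separated_excursions \<gamma> \<epsilon> {0..1} C \<longrightarrow> finite C \<and> card C \<le> N" if "\<epsilon> > 0" for \<epsilon>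
    proof -
      obtain N where "\<forall>\<gamma> C. path \<gamma> \<longrightarrow> curve_class \<gamma> \<in> F \<longrightarrow>
          separated_excursions \<gamma> \<epsilon> {0..1} C \<longrightarrow> finite C \<and> card C \<le> N"
        using compact_closure_imp(2)[OF assms(2) c \<open>\<epsilon> > 0\<close>] by blast
      \<comment> \<open>The successor makes the bound positive.\<close>
      then show ?thesis by (intro exI[of _ "Suc N"]) (auto intro: le_SucI)
    qed
    then show "?bounded \<and> (\<forall>\<epsilon>>0. ?few \<epsilon>)"
      using compact_closure_imp(1)[OF assms(2) c] few by simp
  next
    assume *: "?bounded \<and> (\<forall>\<epsilon>>0. ?few \<epsilon>)"
    show ?compact
      by (rule compact_closure_if[OF assms(2)]) (use * few in simp_all)
  qed
qed

end
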